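(* If $\Lambda$ is cyclic (and nontrivial), then the group $\mathbf F(r,\Lambda,A)$ interprets the Arithmetic $(\mathbb N,+,\times)$ without parameters.
   Context: Maps act on the right: $(\alpha)x$ is the image of $\alpha$ under $x$, and $xy$ means "first $x$, then $y$". Fix a real $r>0$, a subgroup $\Lambda\neq\{1\}$ of the multiplicative group $\mathbb R^*_+$, and an additive subgroup $A\subseteq\mathbb R$ with $r\in A$ and $\lambda A\subseteq A$ for all $\lambda\in\Lambda$. $\mathbf V(r,\Lambda,A)$ is the group of all bijections $x\colon[0,r)\to[0,r)$ such that: $x$ is piecewise affine with finitely many breakpoints and discontinuity points; $x$ is right-continuous everywhere; every slope lies in $\Lambda$; all breakpoints and discontinuity points of $x$, and their images, lie in $A$. $\mathbf F(r,\Lambda,A)$ is the subgroup of elements continuous for the usual topology of $[0,r)$. Groups are first-order structures in the language with one binary function symbol. An interpretation without parameters of $M$ in $N$ is a pair $(n,f)$, $n\in\mathbb N$, $f$ a surjection from a subset of $N^n$ onto $M$ such that for every $X\subseteq M^k$ definable in $M$ without parameters, the preimage of $X$ under the coordinatewise map $f^{\underline k}$ is definable in $N$ without parameters (equivalently: domain of $f$, kernel of $f$, and preimages of graphs of the basic operations/relations of $M$ are definable without parameters). *)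

theory Defs
  imports "HOL-Analysis.Analysis"
begin

text \<open>Elements are maps real => real which are the identity outside [0,r).
  Maps act on the right, so the product xy ("first x, then y") is the
  composition y o x.\<close>

definition in_V :: "real \<Rightarrow> real set \<Rightarrow> real set \<Rightarrow> (real \<Rightarrow> real) \<Rightarrow> bool" where
  "in_V r \<Lambda> A x \<longleftrightarrow>
     bij_betw x {0..<r} {0..<r} \<and>
     (\<forall>t. t \<notin> {0..<r} \<longrightarrow> x t = t) \<and>
     (\<exists>(p :: nat \<Rightarrow> real) (m :: nat).
        p 0 = 0 \<and> p m = r \<and> strict_mono_on {..m} p \<and>
        (\<forall>i\<le>m. p i \<in> A \<and> x (p i) \<in> A) \<and>
        (\<forall>i<m. \<exists>l\<in>\<Lambda>. \<exists>b. \<forall>t\<in>{p i..<p (Suc i)}. x t = l * t + b))"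

definition Vgrp :: "real \<Rightarrow> real set \<Rightarrow> real set \<Rightarrow> (real \<Rightarrow> real) set" where
  "Vgrp r \<Lambda> A = {x. in_V r \<Lambda> A x}"

definition Fgrp :: "real \<Rightarrow> real set \<Rightarrow> real set \<Rightarrow> (real \<Rightarrow> real) set" where
  "Fgrp r \<Lambda> A = {x \<in> Vgrp r \<Lambda> A. continuous_on {0..<r} x}"

definition rmul :: "(real \<Rightarrow> real) \<Rightarrow> (real \<Rightarrow> real) \<Rightarrow> (real \<Rightarrow> real)" where
  "rmul x y = y \<circ> x"

datatype gterm = GVar nat | GMul gterm gterm

datatype gform = GEq gterm gterm | GNot gform | GAnd gform gform | GEx nat gform

fun tfv :: "gterm \<Rightarrow> nat set" where
  "tfv (GVar v) = {v}"
| "tfv (GMul s t) = tfv s \<union> tfv t"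

fun ffv :: "gform \<Rightarrow> nat set" where
  "ffv (GEq s t) = tfv s \<union> tfv t"
| "ffv (GNot \<phi>) = ffv \<phi>"
| "ffv (GAnd \<phi> \<psi>) = ffv \<phi> \<union> ffv \<psi>"
| "ffv (GEx v \<phi>) = ffv \<phi> - {v}"

fun teval :: "('g \<Rightarrow> 'g \<Rightarrow> 'g) \<Rightarrow> (nat \<Rightarrow> 'g) \<Rightarrow> gterm \<Rightarrow> 'g" where
  "teval m e (GVar v) = e v"
| "teval m e (GMul s t) = m (teval m e s) (teval m e t)"

fun fsat :: "'g set \<Rightarrow> ('g \<Rightarrow> 'g \<Rightarrow> 'g) \<Rightarrow> (nat \<Rightarrow> 'g) \<Rightarrow> gform \<Rightarrow> bool" where
  "fsat G m e (GEq s t) = (teval m e s = teval m e t)"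
| "fsat G m e (GNot \<phi>) = (\<not> fsat G m e \<phi>)"
| "fsat G m e (GAnd \<phi> \<psi>) = (fsat G m e \<phi> \<and> fsat G m e \<psi>)"
| "fsat G m e (GEx v \<phi>) = (\<exists>a\<in>G. fsat G m (e(v := a)) \<phi>)"

definition definable0 :: "'g set \<Rightarrow> ('g \<Rightarrow> 'g \<Rightarrow> 'g) \<Rightarrow> nat \<Rightarrow> 'g list set \<Rightarrow> bool" where
  "definable0 G m n S \<longleftrightarrow>
     (\<exists>\<phi>. ffv \<phi> \<subseteq> {..<n} \<and>
        (\<forall>xs. length xs = n \<longrightarrow> set xs \<subseteq> G \<longrightarrow>
           (xs \<in> S \<longleftrightarrow>
             (\<forall>e. range e \<subseteq> G \<longrightarrow> (\<forall>i<n. e i = xs ! i) \<longrightarrow> fsat G m e \<phi>))))"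

definition interprets_arith :: "'g set \<Rightarrow> ('g \<Rightarrow> 'g \<Rightarrow> 'g) \<Rightarrow> bool" where
  "interprets_arith G m \<longleftrightarrow>
     (\<exists>(n :: nat) (D :: 'g list set) (f :: 'g list \<Rightarrow> nat).
        D \<subseteq> {xs. length xs = n \<and> set xs \<subseteq> G} \<and>
        f ` D = UNIV \<and>
        definable0 G m n D \<and>
        definable0 G m (2 * n)
          {xs @ ys | xs ys. xs \<in> D \<and> ys \<in> D \<and> f xs = f ys} \<and>
        definable0 G m (3 * n)
          {xs @ ys @ zs | xs ys zs. xs \<in> D \<and> ys \<in> D \<and> zs \<in> D \<and> f xs + f ys = f zs} \<and>
        definable0 G m (3 * n)
          {xs @ ys @ zs | xs ys zs. xs \<in> D \<and> ys \<in> D \<and> zs \<in> D \<and> f xs * f ys = f zs})"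

end

theory Submission
  imports Defs
begin

text \<open>
  Let \<open>p > 1\<close> generate \<open>\<Lambda>\<close>. Sending an element to the exponents of its slopes at \<open>0\<close> and at \<open>r\<close> is a
  surjective homomorphism \<open>val\<close> from \<open>F\<close> onto \<open>\<int>\<^sup>2\<close>.
  Its kernel is definable: \<open>y\<close> is trivial near both ends iff for every \<open>z\<close> with nonabelian
  centralizer (equivalently, fixing an interval pointwise) some conjugate of \<open>y\<close> commutes with \<open>z\<close>.
  Indeed the support of such a \<open>y\<close> can be pushed into the fixed interval, whereas a bump of \<open>y\<close> at an end
  obstructs commutation with a bump \<open>z\<close> there whose two slope exponents have another ratio.
  The elements without fixed points in \<open>(0, r)\<close> are then definable as the \<open>x \<noteq> 1\<close> whose centralizer
  can make any two kernel elements commute by conjugating one of them; their values are the pairs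
  \<open>(a, b)\<close> with \<open>a * b < 0\<close>. If \<open>y\<close> commutes with such an \<open>x\<close>, then \<open>val x\<close> and \<open>val y\<close> are collinear,
  because an element of the centralizer of \<open>x\<close> with trivial germ at \<open>0\<close> is trivial.
  Hence \<open>\<int>\<^sup>2\<close> with addition, the quadrants \<open>a * b < 0\<close> and collinearity is interpretable. There
  \<open>\<plusminus>(1, -1)\<close> and the union of the axes are definable, \<open>n\<close> is encoded by \<open>\<plusminus>(n, -n)\<close>, and multiplication by
  \<open>n\<close> is read off the multiples of \<open>(n, -1)\<close>.
\<close>

section \<open>Definability up to a coordinate map\<close>

fun tren :: "(nat \<Rightarrow> nat) \<Rightarrow> gterm \<Rightarrow> gterm" where
  "tren \<sigma> (GVar v) = GVar (\<sigma> v)"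
| "tren \<sigma> (GMul s t) = GMul (tren \<sigma> s) (tren \<sigma> t)"

text \<open>A bound variable is replaced by an index above the images of all free variables of its
  scope, so renaming never captures a variable, even when \<open>\<sigma>\<close> is not
  injective.\<close>

fun fren :: "(nat \<Rightarrow> nat) \<Rightarrow> gform \<Rightarrow> gform" where
  "fren \<sigma> (GEq s t) = GEq (tren \<sigma> s) (tren \<sigma> t)"
| "fren \<sigma> (GNot \<phi>) = GNot (fren \<sigma> \<phi>)"
| "fren \<sigma> (GAnd \<phi> \<psi>) = GAnd (fren \<sigma> \<phi>) (fren \<sigma> \<psi>)"
| "fren \<sigma> (GEx v \<phi>) =
     (let w = Suc (Max (insert 0 (\<sigma> ` ffv \<phi>))) in GEx w (fren (\<sigma>(v := w)) \<phi>))"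

lemma finite_tfv: "finite (tfv t)"
  by (induction t) auto

lemma finite_ffv: "finite (ffv \<phi>)"
  by (induction \<phi>) (auto simp: finite_tfv)

lemma teval_cong: "(\<And>i. i \<in> tfv t \<Longrightarrow> e i = e' i) \<Longrightarrow> teval m e t = teval m e' t"
  by (induction t) auto

lemma fsat_cong: "(\<And>i. i \<in> ffv \<phi> \<Longrightarrow> e i = e' i) \<Longrightarrow> fsat G m e \<phi> = fsat G m e' \<phi>"
proof (induction \<phi> arbitrary: e e')
  case (GEq s t)
  then show ?case using teval_cong[of s e e' m] teval_cong[of t e e' m] by simp
next
  case (GNot \<phi>)
  have "fsat G m e \<phi> = fsat G m e' \<phi>" by (rule GNot.IH) (use GNot.prems in auto)
  then show ?case by simp
next
  case (GAnd \<phi> \<psi>)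
  have "fsat G m e \<phi> = fsat G m e' \<phi>" by (rule GAnd.IH) (use GAnd.prems in auto)
  moreover have "fsat G m e \<psi> = fsat G m e' \<psi>" by (rule GAnd.IH) (use GAnd.prems in auto)
  ultimately show ?case by simp
next
  case (GEx v \<phi>)
  have "fsat G m (e(v := a)) \<phi> = fsat G m (e'(v := a)) \<phi>" for a
    by (rule GEx.IH) (use GEx.prems in auto)
  then show ?case by simp
qed

lemma fresh_notin:
  assumes "finite S" "i \<in> S"
  shows "\<sigma> i \<noteq> Suc (Max (insert (0::nat) (\<sigma> ` S)))"
proof -
  have "\<sigma> i \<le> Max (insert 0 (\<sigma> ` S))" using assms by (intro Max_ge) auto
  then show ?thesis by linarith
qed

lemma teval_tren: "teval m e (tren \<sigma> t) = teval m (\<lambda>i. e (\<sigma> i)) t"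
  by (induction t) auto

lemma tfv_tren: "tfv (tren \<sigma> t) = \<sigma> ` tfv t"
  by (induction t) auto

lemma fsat_fren: "fsat G m e (fren \<sigma> \<phi>) = fsat G m (\<lambda>i. e (\<sigma> i)) \<phi>"
proof (induction \<phi> arbitrary: e \<sigma>)
  case (GEx v \<phi>)
  define w where "w = Suc (Max (insert 0 (\<sigma> ` ffv \<phi>)))"
  have "fsat G m (\<lambda>i. (e(w := a)) ((\<sigma>(v := w)) i)) \<phi> = fsat G m ((\<lambda>i. e (\<sigma> i))(v := a)) \<phi>" for a
    by (rule fsat_cong) (use fresh_notin[OF finite_ffv, of _ \<phi> \<sigma>] in \<open>auto simp: w_def\<close>)
  then show ?case by (simp add: GEx.IH w_def[symmetric] Let_def del: fun_upd_apply)
qed (auto simp: teval_tren)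

lemma ffv_fren: "ffv (fren \<sigma> \<phi>) \<subseteq> \<sigma> ` ffv \<phi>"
proof (induction \<phi> arbitrary: \<sigma>)
  case (GEx v \<phi>)
  define w where "w = Suc (Max (insert 0 (\<sigma> ` ffv \<phi>)))"
  have "ffv (fren (\<sigma>(v := w)) \<phi>) - {w} \<subseteq> \<sigma> ` (ffv \<phi> - {v})"
  proof
    fix i assume i: "i \<in> ffv (fren (\<sigma>(v := w)) \<phi>) - {w}"
    then obtain j where "j \<in> ffv \<phi>" "i = (\<sigma>(v := w)) j" using GEx.IH[of "\<sigma>(v := w)"] by blast
    with i show "i \<in> \<sigma> ` (ffv \<phi> - {v})" by (cases "j = v") auto
  qed
  then show ?case by (simp add: w_def[symmetric] Let_def)
qed (simp_all add: tfv_tren image_Un, blast)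

text \<open>Relations on values are predicates of an environment \<open>nat \<Rightarrow> 'w\<close>. Quantifiers below follow the de Bruijn
  convention: index 0 is the bound variable and the other indices are shifted.\<close>
definition definable_via :: "'g set \<Rightarrow> ('g \<Rightarrow> 'g \<Rightarrow> 'g) \<Rightarrow> ('g \<Rightarrow> 'w) \<Rightarrow> ((nat \<Rightarrow> 'w) \<Rightarrow> bool) \<Rightarrow> bool" where
  "definable_via G m v P \<longleftrightarrow> (\<exists>\<phi>. \<forall>e. range e \<subseteq> G \<longrightarrow> (fsat G m e \<phi> \<longleftrightarrow> P (\<lambda>i. v (e i))))"

text \<open>Absorbs the coordinate map into the predicate: definability of a relation between values
  becomes a question about the group elements themselves.\<close>

lemma definable_via_id_iff: "definable_via G m v P \<longleftrightarrow> definable_via G m (\<lambda>x. x) (\<lambda>e. P (\<lambda>i. v (e i)))"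
  by (simp add: definable_via_def)

text \<open>\<open>definable0\<close> wants a formula with free variables below \<open>n\<close>,
  whereas \<open>definable_via\<close> puts no bound on them. By the third premise \<open>P\<close>
  depends only on the first \<open>n\<close> entries, so all other variables may be
  redirected.\<close>

lemma definable_via_imp_definable0:
  assumes "definable_via G m (\<lambda>x. x) P" "n > 0"
    and "\<And>e xs. \<lbrakk>range e \<subseteq> G; set xs \<subseteq> G; length xs = n; \<And>i. i < n \<Longrightarrow> e i = xs ! i\<rbrakk>
           \<Longrightarrow> P e \<longleftrightarrow> xs \<in> S"
  shows "definable0 G m n S"
proof -
  obtain \<phi> where \<phi>: "\<And>e. range e \<subseteq> G \<Longrightarrow> fsat G m e \<phi> \<longleftrightarrow> P e"
    using assms(1) by (auto simp: definable_via_def)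
  let ?\<sigma> = "\<lambda>i. if i < n then i else 0"
  have "ffv (fren ?\<sigma> \<phi>) \<subseteq> {..<n}" using ffv_fren[of ?\<sigma> \<phi>] \<open>n > 0\<close> by auto
  moreover have "fsat G m e (fren ?\<sigma> \<phi>) \<longleftrightarrow> xs \<in> S"
    if e: "range e \<subseteq> G" "set xs \<subseteq> G" "length xs = n" "\<And>i. i < n \<Longrightarrow> e i = xs ! i" for e xs
  proof -
    have "range (\<lambda>i. e (?\<sigma> i)) \<subseteq> G" using e(1) by auto
    moreover have "P (\<lambda>i. e (?\<sigma> i)) \<longleftrightarrow> xs \<in> S" by (rule assms(3)) (use e in auto)
    ultimately show ?thesis by (simp add: fsat_fren \<phi>)
  qed
  \<comment> \<open>\<open>definable0\<close> quantifies universally over the environments extending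
    \<open>xs\<close>; one such environment is needed to read membership back from it.\<close>
  moreover have "\<exists>e. range e \<subseteq> G \<and> (\<forall>i<n. e i = xs ! i)" if "set xs \<subseteq> G" "length xs = n" for xs
    using that \<open>n > 0\<close> by (intro exI[of _ "\<lambda>i. if i < n then xs ! i else xs ! 0"]) auto
  ultimately show ?thesis unfolding definable0_def
    by (intro exI[of _ "fren ?\<sigma> \<phi>"] conjI allI impI iffI) blast+
qed

text \<open>The coordinate map \<open>v\<close> need not be injective; definability of equality of
  values says that its kernel is definable. Quantifiers on values range over
  \<open>W\<close>.\<close>

locale valued_structure =
  fixes G :: "'g set" and m :: "'g \<Rightarrow> 'g \<Rightarrow> 'g" and v :: "'g \<Rightarrow> 'w" and W :: "'w set"
  assumes W: "v ` G = W" and definable_via_eq: "definable_via G m v (\<lambda>e. e 0 = e 1)"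
begin

abbreviation D where "D \<equiv> definable_via G m v"

lemma definable_via_cong: "(\<And>e. range e \<subseteq> W \<Longrightarrow> P e = P' e) \<Longrightarrow> D P \<Longrightarrow> D P'"
proof -
  assume *: "\<And>e. range e \<subseteq> W \<Longrightarrow> P e = P' e" and "D P"
  have "P (\<lambda>i. v (e i)) = P' (\<lambda>i. v (e i))" if "range e \<subseteq> G" for e
    using that W by (intro *) auto
  with \<open>D P\<close> show "D P'" unfolding definable_via_def by auto
qed

section \<open>Closure of definable predicates under connectives, renaming and quantifiers\<close>

lemma definable_via_not: "D P \<Longrightarrow> D (\<lambda>e. \<not> P e)"
  unfolding definable_via_def
proof (elim exE, intro exI)
  show "\<forall>e. range e \<subseteq> G \<longrightarrow> fsat G m e \<phi> = P (\<lambda>i. v (e i)) \<Longrightarrow>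
      \<forall>e. range e \<subseteq> G \<longrightarrow> fsat G m e (GNot \<phi>) = (\<not> P (\<lambda>i. v (e i)))" for \<phi> by simp
qed

lemma definable_via_conj:
  assumes "D P" "D Q" shows "D (\<lambda>e. P e \<and> Q e)"
proof -
  obtain \<phi> \<psi> where "\<And>e. range e \<subseteq> G \<Longrightarrow> fsat G m e \<phi> \<longleftrightarrow> P (\<lambda>i. v (e i))"
    "\<And>e. range e \<subseteq> G \<Longrightarrow> fsat G m e \<psi> \<longleftrightarrow> Q (\<lambda>i. v (e i))"
    using assms unfolding definable_via_def by blast
  then show ?thesis unfolding definable_via_def by (intro exI[of _ "GAnd \<phi> \<psi>"]) auto
qed

lemma definable_via_disj:
  assumes "D P" "D Q" shows "D (\<lambda>e. P e \<or> Q e)"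
  using definable_via_not[OF definable_via_conj[OF definable_via_not[OF assms(1)] definable_via_not[OF assms(2)]]] by simp

lemma definable_via_imp:
  assumes "D P" "D Q" shows "D (\<lambda>e. P e \<longrightarrow> Q e)"
  using definable_via_not[OF definable_via_conj[OF assms(1) definable_via_not[OF assms(2)]]] by simp

lemma definable_via_ren:
  assumes "D P" shows "D (\<lambda>e. P (\<lambda>i. e (\<sigma> i)))"
proof -
  obtain \<phi> where \<phi>: "\<And>e. range e \<subseteq> G \<Longrightarrow> fsat G m e \<phi> \<longleftrightarrow> P (\<lambda>i. v (e i))"
    using assms unfolding definable_via_def by blast
  have "fsat G m e (fren \<sigma> \<phi>) \<longleftrightarrow> P (\<lambda>i. v (e (\<sigma> i)))" if "range e \<subseteq> G" for e
    unfolding fsat_fren using that by (intro \<phi>) auto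
  then show ?thesis unfolding definable_via_def by (intro exI[of _ "fren \<sigma> \<phi>"]) simp
qed

lemma definable_via_ex:
  assumes "D (\<lambda>e. P (e 0) (\<lambda>i. e (Suc i)))" shows "D (\<lambda>e. \<exists>z\<in>W. P z e)"
proof -
  obtain \<phi> where \<phi>: "\<And>e. range e \<subseteq> G \<Longrightarrow> fsat G m e \<phi> \<longleftrightarrow> P (v (e 0)) (\<lambda>i. v (e (Suc i)))"
    using assms unfolding definable_via_def by blast
  \<comment> \<open>\<open>n\<close> lies above every free variable of \<open>\<phi>\<close>, so it
    can hold the quantified element; \<open>?\<sigma>\<close> sends the de Bruijn index 0 to it and
    lowers the other indices by one.\<close>
  define n where "n = Suc (Max (insert 0 (ffv \<phi>)))"
  let ?\<sigma> = "case_nat n (\<lambda>i. i)"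
  have n: "i < n" if "i \<in> ffv \<phi>" for i
    using that finite_ffv[of \<phi>] by (auto simp: n_def less_Suc_eq_le)
  have "fsat G m (e(n := a)) (fren ?\<sigma> \<phi>) \<longleftrightarrow> P (v a) (\<lambda>i. v (e i))"
    if "range e \<subseteq> G" "a \<in> G" for e a
  proof -
    have "fsat G m (e(n := a)) (fren ?\<sigma> \<phi>) = fsat G m (case_nat a e) \<phi>"
      unfolding fsat_fren
    proof (rule fsat_cong)
      fix i assume "i \<in> ffv \<phi>"
      with n[of i] show "(e(n := a)) (?\<sigma> i) = case_nat a e i" by (cases i) auto
    qed
    also have "\<dots> \<longleftrightarrow> P (v a) (\<lambda>i. v (e i))"
      by (subst \<phi>) (use that in \<open>auto simp: image_subset_iff split: nat.splits\<close>)
    finally show ?thesis .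
  qed
  then have "fsat G m e (GEx n (fren ?\<sigma> \<phi>)) \<longleftrightarrow> (\<exists>z\<in>W. P z (\<lambda>i. v (e i)))"
    if "range e \<subseteq> G" for e
    using that W[symmetric] by auto
  then show ?thesis unfolding definable_via_def by blast
qed

lemma definable_via_all:
  assumes "D (\<lambda>e. P (e 0) (\<lambda>i. e (Suc i)))" shows "D (\<lambda>e. \<forall>z\<in>W. P z e)"
  using definable_via_not[OF definable_via_ex[where P = "\<lambda>z e. \<not> P z e", OF definable_via_not[OF assms]]] by simp

text \<open>Functions with definable graph act as terms, so that sums, differences and zero can be
  substituted into definable relations.\<close>

definition definable_term :: "((nat \<Rightarrow> 'w) \<Rightarrow> 'w) \<Rightarrow> bool" where
  "definable_term s \<longleftrightarrow> (\<forall>e. range e \<subseteq> W \<longrightarrow> s e \<in> W) \<and> D (\<lambda>e. e 0 = s (\<lambda>i. e (Suc i)))"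

lemma definable_term_var: "definable_term (\<lambda>e. e i)"
proof -
  have "D (\<lambda>e. e 0 = e (Suc i))" using definable_via_ren[OF definable_via_eq, of "case_nat 0 (\<lambda>_. Suc i)"] by simp
  then show ?thesis by (auto simp: definable_term_def)
qed

text \<open>The value of \<open>s\<close> is named by an auxiliary quantifier and described through
  its graph.\<close>

lemma definable_via_app1:
  assumes "D (\<lambda>e. R (e 0))" "definable_term s" shows "D (\<lambda>e. R (s e))"
proof -
  have "D (\<lambda>e. \<exists>z\<in>W. z = s e \<and> R z)"
    by (intro definable_via_ex definable_via_conj assms(1)) (use assms(2) in \<open>simp add: definable_term_def\<close>)
  then show ?thesis
    by (rule definable_via_cong[rotated]) (use assms(2) in \<open>auto simp: definable_term_def\<close>)
qed

lemma definable_via_app2: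
  assumes "D (\<lambda>e. R (e 0) (e 1))" "definable_term s" "definable_term t" shows "D (\<lambda>e. R (s e) (t e))"
proof -
  \<comment> \<open>Below the two quantifiers the value of \<open>s\<close> has index 1, that of
    \<open>t\<close> has index 0, and the environment starts at index 2.\<close>
  have "D (\<lambda>e. e 1 = s (\<lambda>i. e (Suc (Suc i))))"
    using definable_via_ren[of "\<lambda>e. e 0 = s (\<lambda>i. e (Suc i))" Suc] assms(2) by (simp add: definable_term_def)
  moreover have "D (\<lambda>e. e 0 = t (\<lambda>i. e (Suc (Suc i))))"
    using definable_via_ren[of "\<lambda>e. e 0 = t (\<lambda>i. e (Suc i))" "case_nat 0 (\<lambda>i. Suc (Suc i))"] assms(3)
    by (simp add: definable_term_def)
  moreover have "D (\<lambda>e. R (e 1) (e 0))"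
    using definable_via_ren[OF assms(1), of "case_nat 1 (\<lambda>i. 0)"] by simp
  ultimately have "D (\<lambda>e. \<exists>a\<in>W. \<exists>b\<in>W. a = s e \<and> b = t e \<and> R a b)"
    by (intro definable_via_ex definable_via_conj) simp_all
  then show ?thesis
    by (rule definable_via_cong[rotated]) (use assms(2,3) in \<open>auto simp: definable_term_def\<close>)
qed

lemmas definable_via_equal = definable_via_app2[OF definable_via_eq]

lemma definable_term_op:
  assumes "D (\<lambda>e. e 2 = f (e 0) (e 1))" "\<And>a b. a \<in> W \<Longrightarrow> b \<in> W \<Longrightarrow> f a b \<in> W"
    and "definable_term s" "definable_term t"
  shows "definable_term (\<lambda>e. f (s e) (t e))"
proof -
  \<comment> \<open>Below the two quantifiers the result has index 2, the operands have indices 1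
    and 0, and the environment starts at index 3.\<close>
  have s: "D (\<lambda>e. e 1 = s (\<lambda>i. e (Suc (Suc (Suc i)))))"
    using definable_via_ren[of "\<lambda>e. e 0 = s (\<lambda>i. e (Suc i))" "case_nat 1 (\<lambda>i. Suc (Suc (Suc i)))"] assms(3)
    by (simp add: definable_term_def)
  have t: "D (\<lambda>e. e 0 = t (\<lambda>i. e (Suc (Suc (Suc i)))))"
    using definable_via_ren[of "\<lambda>e. e 0 = t (\<lambda>i. e (Suc i))" "case_nat 0 (\<lambda>i. Suc (Suc (Suc i)))"] assms(4)
    by (simp add: definable_term_def)
  have f: "D (\<lambda>e. e 2 = f (e 1) (e 0))"
    using definable_via_ren[OF assms(1), of "case_nat 1 (case_nat 0 (\<lambda>i. 2))"] by (simp add: numeral_2_eq_2)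
  have "D (\<lambda>e. \<exists>a\<in>W. \<exists>b\<in>W. a = s (\<lambda>i. e (Suc i)) \<and> b = t (\<lambda>i. e (Suc i)) \<and> e 0 = f a b)"
    by (intro definable_via_ex definable_via_conj) (use s t f in \<open>simp_all add: numeral_2_eq_2\<close>)
  then have "D (\<lambda>e. e 0 = f (s (\<lambda>i. e (Suc i))) (t (\<lambda>i. e (Suc i))))"
  proof (rule definable_via_cong[rotated])
    fix e :: "nat \<Rightarrow> 'w" assume "range e \<subseteq> W"
    then have "range (\<lambda>i. e (Suc i)) \<subseteq> W" by auto
    then show "(\<exists>a\<in>W. \<exists>b\<in>W. a = s (\<lambda>i. e (Suc i)) \<and> b = t (\<lambda>i. e (Suc i)) \<and> e 0 = f a b) \<longleftrightarrow>
        e 0 = f (s (\<lambda>i. e (Suc i))) (t (\<lambda>i. e (Suc i)))"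
      using assms(3,4) by (auto simp: definable_term_def)
  qed
  then show ?thesis using assms by (auto simp: definable_term_def)
qed

end

section \<open>Arithmetic in the plane\<close>

definition quad :: "int \<times> int \<Rightarrow> bool" where
  "quad a \<longleftrightarrow> fst a * snd a < 0"

text \<open>Each of the two open quadrants is closed under addition, so adding \<open>a\<close> can
  lead \<open>c\<close> out of their union only if \<open>a\<close> and \<open>c\<close> lie in
  opposite quadrants. A common \<open>c\<close> thus puts \<open>a\<close> and \<open>b\<close> into
  the same quadrant.\<close>

definition samesign :: "int \<times> int \<Rightarrow> int \<times> int \<Rightarrow> bool" where
  "samesign a b \<longleftrightarrow> quad a \<and> quad b \<and> (\<exists>c. quad c \<and> \<not> quad (c + a) \<and> \<not> quad (c + b))"

text \<open>The translations that map the open quadrant of \<open>s\<close> into itself form the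
  closed quadrant.\<close>

definition qcone :: "int \<times> int \<Rightarrow> int \<times> int \<Rightarrow> bool" where
  "qcone s w \<longleftrightarrow> (\<forall>b. samesign s b \<longrightarrow> samesign s (w + b))"

text \<open>Describes the least point of an open quadrant in the order whose positive cone is the
  closed quadrant.\<close>

definition qunit :: "int \<times> int \<Rightarrow> bool" where
  "qunit u \<longleftrightarrow> quad u \<and> (\<forall>b. samesign u b \<longrightarrow> qcone u (b - u))"

text \<open>Axis points are what the closed quadrants have in excess of the open ones.\<close>

definition axis :: "int \<times> int \<Rightarrow> bool" where
  "axis a \<longleftrightarrow> (\<exists>s. quad s \<and> qcone s a \<and> \<not> quad a)"

text \<open>Exchanging the coordinates preserves addition and \<open>quad\<close>, so these cannot
  tell the two axes apart. A nonzero axis point \<open>\<alpha>\<close> selects one: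
  \<open>along \<alpha>\<close> is the axis through it and \<open>across \<alpha>\<close> the other
  one.\<close>

definition along :: "int \<times> int \<Rightarrow> int \<times> int \<Rightarrow> bool" where
  "along \<alpha> z \<longleftrightarrow> axis z \<and> axis (z + \<alpha>)"

definition across :: "int \<times> int \<Rightarrow> int \<times> int \<Rightarrow> bool" where
  "across \<alpha> z \<longleftrightarrow> axis z \<and> (z = 0 \<or> \<not> axis (z + \<alpha>))"

definition eq_up_to_sign :: "int \<times> int \<Rightarrow> int \<times> int \<Rightarrow> bool" where
  "eq_up_to_sign a b \<longleftrightarrow> a = b \<or> a + b = 0"

text \<open>Numbers are coded only up to sign, so the representative \<open>b'\<close> is taken in
  the quadrant of \<open>a\<close>, where absolute values add up.\<close>

definition add_rel :: "int \<times> int \<Rightarrow> int \<times> int \<Rightarrow> int \<times> int \<Rightarrow> bool" where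
  "add_rel a b c \<longleftrightarrow> (\<exists>b' c'. eq_up_to_sign b b' \<and> eq_up_to_sign c c' \<and> c' = a + b' \<and> (a = 0 \<or> b' = 0 \<or> samesign a b'))"

lemma quad_iff: "quad a \<longleftrightarrow> fst a > 0 \<and> snd a < 0 \<or> fst a < 0 \<and> snd a > 0"
  by (auto simp: quad_def mult_less_0_iff)

lemma samesign_iff: "samesign a b \<longleftrightarrow>
    fst a > 0 \<and> snd a < 0 \<and> fst b > 0 \<and> snd b < 0 \<or> fst a < 0 \<and> snd a > 0 \<and> fst b < 0 \<and> snd b > 0"
  (is "_ \<longleftrightarrow> ?P \<or> ?N")
proof
  assume "samesign a b"
  then obtain c where "quad a" "quad b" "quad c" "\<not> quad (c + a)" "\<not> quad (c + b)"
    by (auto simp: samesign_def)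
  then show "?P \<or> ?N" unfolding quad_iff fst_add snd_add by linarith
next
  assume "?P \<or> ?N"
  then show "samesign a b"
  proof
    assume ?P
    \<comment> \<open>The witness lies so far to the left that adding \<open>a\<close> or
      \<open>b\<close> keeps its first coordinate negative, while its second coordinate 1 ceases to
      be positive.\<close>
    then show ?thesis unfolding samesign_def
      by (intro conjI exI[of _ "(- fst a - fst b, 1)"]) (auto simp: quad_iff)
  next
    assume ?N
    then show ?thesis unfolding samesign_def
      by (intro conjI exI[of _ "(- fst a - fst b, -1)"]) (auto simp: quad_iff)
  qed
qed

lemma qcone_iff: assumes "quad s"
  shows "qcone s w \<longleftrightarrow> (if fst s > 0 then fst w \<ge> 0 \<and> snd w \<le> 0 else fst w \<le> 0 \<and> snd w \<ge> 0)"
proof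
  assume "qcone s w"
  \<comment> \<open>The corner points of the two quadrants are the sharpest tests.\<close>
  then have "samesign s (w + (1, -1)) \<or> \<not> samesign s (1, -1)" "samesign s (w + (-1, 1)) \<or> \<not> samesign s (-1, 1)"
    by (auto simp: qcone_def)
  then show "if fst s > 0 then fst w \<ge> 0 \<and> snd w \<le> 0 else fst w \<le> 0 \<and> snd w \<ge> 0"
    using assms by (auto simp: samesign_iff quad_iff)
next
  assume "if fst s > 0 then fst w \<ge> 0 \<and> snd w \<le> 0 else fst w \<le> 0 \<and> snd w \<ge> 0"
  then show "qcone s w" using assms by (auto simp: qcone_def samesign_iff quad_iff split: if_splits)
qed

lemma qunit_iff: "qunit u \<longleftrightarrow> u = (1, -1) \<or> u = (-1, 1)"
proof
  assume u: "qunit u"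
  then have q: "quad u" by (simp add: qunit_def)
  have "samesign u (1, -1) \<longrightarrow> qcone u ((1, -1) - u)" "samesign u (-1, 1) \<longrightarrow> qcone u ((-1, 1) - u)"
    using u by (auto simp: qunit_def)
  then show "u = (1, -1) \<or> u = (-1, 1)"
    using q unfolding qcone_iff[OF q] samesign_iff quad_iff by (auto simp: prod_eq_iff split: if_splits)
next
  assume u: "u = (1, -1) \<or> u = (-1, 1)"
  then have q: "quad u" by (auto simp: quad_iff)
  show "qunit u" unfolding qunit_def using u q by (auto simp: qcone_iff samesign_iff)
qed

lemma axis_iff: "axis a \<longleftrightarrow> fst a = 0 \<or> snd a = 0"
proof
  assume "axis a"
  then obtain s where "quad s" "qcone s a" "\<not> quad a" by (auto simp: axis_def)
  then show "fst a = 0 \<or> snd a = 0" by (auto simp: qcone_iff quad_iff split: if_splits)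
next
  assume a: "fst a = 0 \<or> snd a = 0"
  have q: "quad (1, -1)" "quad (-1, 1)" by (auto simp: quad_iff)
  have "qcone (1, -1) a \<or> qcone (-1, 1) a" using a unfolding qcone_iff[OF q(1)] qcone_iff[OF q(2)] by auto
  moreover have "\<not> quad a" using a by (auto simp: quad_iff)
  ultimately show "axis a" using q unfolding axis_def by blast
qed

lemma along_across_vertical:
  assumes "k \<noteq> 0" shows "along (0, k) z \<longleftrightarrow> fst z = 0" "across (0, k) z \<longleftrightarrow> snd z = 0"
  using assms by (auto simp: along_def across_def axis_iff prod_eq_iff)

lemma along_across_horizontal:
  assumes "k \<noteq> 0" shows "along (k, 0) z \<longleftrightarrow> snd z = 0" "across (k, 0) z \<longleftrightarrow> fst z = 0"
  using assms by (auto simp: along_def across_def axis_iff prod_eq_iff)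

lemma eq_up_to_sign_iff:
  assumes "snd a = - fst a" "snd b = - fst b" shows "eq_up_to_sign a b \<longleftrightarrow> \<bar>fst a\<bar> = \<bar>fst b\<bar>"
  using assms by (auto simp: eq_up_to_sign_def prod_eq_iff)

lemma add_rel_iff:
  assumes "snd a = - fst a" "snd b = - fst b" "snd c = - fst c"
  shows "add_rel a b c \<longleftrightarrow> \<bar>fst a\<bar> + \<bar>fst b\<bar> = \<bar>fst c\<bar>"
proof
  assume "add_rel a b c"
  then obtain b' c' where *: "eq_up_to_sign b b'" "eq_up_to_sign c c'" "c' = a + b'" "a = 0 \<or> b' = 0 \<or> samesign a b'"
    unfolding add_rel_def by blast
  then have "\<bar>fst b\<bar> = \<bar>fst b'\<bar>" "\<bar>fst c\<bar> = \<bar>fst c'\<bar>" by (auto simp: eq_up_to_sign_def prod_eq_iff)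
  moreover have "\<bar>fst a + fst b'\<bar> = \<bar>fst a\<bar> + \<bar>fst b'\<bar>" using *(4) by (auto simp: samesign_iff)
  ultimately show "\<bar>fst a\<bar> + \<bar>fst b\<bar> = \<bar>fst c\<bar>" using *(3) by simp
next
  assume eq: "\<bar>fst a\<bar> + \<bar>fst b\<bar> = \<bar>fst c\<bar>"
  define b' where "b' = (if fst a * fst b \<ge> 0 then b else - b)"
  have b': "eq_up_to_sign b b'" "snd b' = - fst b'" using assms by (auto simp: b'_def eq_up_to_sign_def)
  have s: "fst a \<ge> 0 \<and> fst b' \<ge> 0 \<or> fst a \<le> 0 \<and> fst b' \<le> 0"
    by (auto simp: b'_def zero_le_mult_iff)
  then have "a = 0 \<or> b' = 0 \<or> samesign a b'" using assms(1) b'(2) by (auto simp: samesign_iff prod_eq_iff)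
  moreover have "\<bar>fst b'\<bar> = \<bar>fst b\<bar>" by (auto simp: b'_def)
  then have "\<bar>fst c\<bar> = \<bar>fst (a + b')\<bar>" using eq s by auto
  then have "eq_up_to_sign c (a + b')" using assms b'(2) by (subst eq_up_to_sign_iff) auto
  ultimately show "add_rel a b c" using b'(1) unfolding add_rel_def by blast
qed

text \<open>\<open>M\<close> is only bounded from two sides: it implies collinearity and contains
  all integer multiples. This much suffices for arithmetic and is what centralizers provide.\<close>

locale slope_plane = valued_structure G m v UNIV
  for G :: "'g set" and m and v :: "'g \<Rightarrow> int \<times> int" +
  fixes M :: "int \<times> int \<Rightarrow> int \<times> int \<Rightarrow> bool"
  assumes definable_via_plus: "definable_via G m v (\<lambda>e. e 2 = e 0 + e 1)"
    and definable_via_quad0: "definable_via G m v (\<lambda>e. quad (e 0))"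
    and definable_via_M0: "definable_via G m v (\<lambda>e. M (e 0) (e 1))"
    and M_D: "M a b \<Longrightarrow> quad a \<and> fst a * snd b = snd a * fst b"
    and M_I: "quad a \<Longrightarrow> M a (n * fst a, n * snd a)"
begin

definition diag :: "int \<times> int \<Rightarrow> bool" where
  "diag a \<longleftrightarrow> (\<exists>u. qunit u \<and> M u a)"

text \<open>For vertical \<open>\<alpha>\<close> the conditions read
  \<open>w = (fst a, snd u)\<close> and \<open>y = (fst c', snd b)\<close>, so collinearity of
  \<open>w\<close> and \<open>y\<close> says that \<open>a\<close> is to the unit as
  \<open>c'\<close> is to \<open>b\<close>. The case \<open>a = 0\<close> stands apart because
  \<open>w\<close> would then lie on an axis, outside the domain of \<open>M\<close>.\<close>

definition mul_rel :: "int \<times> int \<Rightarrow> int \<times> int \<Rightarrow> int \<times> int \<Rightarrow> bool" where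
  "mul_rel a b c \<longleftrightarrow> a = 0 \<and> c = 0 \<or>
     (\<exists>u w y c' \<alpha>. qunit u \<and> eq_up_to_sign c c' \<and> axis \<alpha> \<and> \<alpha> \<noteq> 0 \<and> along \<alpha> (w - a) \<and> across \<alpha> (w - u) \<and>
        M w y \<and> along \<alpha> (y - c') \<and> across \<alpha> (y - b))"

lemma diag_iff: "diag a \<longleftrightarrow> snd a = - fst a"
proof
  assume "diag a"
  then obtain u where "qunit u" "fst u * snd a = snd u * fst a" using M_D by (auto simp: diag_def)
  then show "snd a = - fst a" by (auto simp: qunit_iff)
next
  assume "snd a = - fst a"
  then have "M (1, -1) a" using M_I[of "(1, -1)" "fst a"] by (simp add: quad_iff prod_eq_iff) (metis prod.collapse)
  then show "diag a" by (auto simp: diag_def qunit_iff)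
qed

text \<open>The slope pair \<open>(fst a, \<mp>1)\<close> spans a line on which the second coordinate counts multiples of \<open>fst a\<close>.\<close>
lemma mul_rel_iff:
  assumes "diag a" "diag b" "diag c"
  shows "mul_rel a b c \<longleftrightarrow> \<bar>fst a\<bar> * \<bar>fst b\<bar> = \<bar>fst c\<bar>"
proof
  assume "mul_rel a b c"
  then consider "a = 0" "c = 0" | u w y c' \<alpha> where "qunit u" "eq_up_to_sign c c'" "axis \<alpha>" "\<alpha> \<noteq> 0" "along \<alpha> (w - a)"
    "across \<alpha> (w - u)" "M w y" "along \<alpha> (y - c')" "across \<alpha> (y - b)" by (auto simp: mul_rel_def)
  then show "\<bar>fst a\<bar> * \<bar>fst b\<bar> = \<bar>fst c\<bar>"
  proof cases
    case 2
    have c': "\<bar>fst c'\<bar> = \<bar>fst c\<bar>" "snd c' = - fst c'"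
      using 2(2) assms(3) by (auto simp: eq_up_to_sign_def diag_iff prod_eq_iff)
    have col: "fst w * snd y = snd w * fst y" using M_D[OF 2(7)] by simp
    have u: "\<bar>fst u\<bar> = 1" "snd u = - fst u" using 2(1) by (auto simp: qunit_iff)
    have ab: "snd a = - fst a" "snd b = - fst b" using assms by (auto simp: diag_iff)
    have "fst a * fst b = fst u * fst c'"
    \<comment> \<open>\<open>\<alpha>\<close> may lie on either axis; the horizontal reading
      exchanges the coordinates and yields the same product.\<close>
    proof (cases "fst \<alpha> = 0")
      case True
      then obtain k where "\<alpha> = (0, k)" "k \<noteq> 0" using 2(4) by (cases \<alpha>) (auto simp: zero_prod_def)
      then have "fst w = fst a" "snd w = snd u" "fst y = fst c'" "snd y = snd b"
        using 2(5,6,8,9) along_across_vertical[of k] by auto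
      then show ?thesis using col u ab by simp
    next
      case False
      then obtain k where "\<alpha> = (k, 0)" "k \<noteq> 0" using 2(3) by (cases \<alpha>) (auto simp: axis_iff)
      then have "snd w = snd a" "fst w = fst u" "snd y = snd c'" "fst y = fst b"
        using 2(5,6,8,9) along_across_horizontal[of k] by auto
      then show ?thesis using col u ab c' by simp
    qed
    then have "\<bar>fst a\<bar> * \<bar>fst b\<bar> = \<bar>fst u\<bar> * \<bar>fst c'\<bar>" by (metis abs_mult)
    then show ?thesis using u c' by simp
  qed auto
next
  assume eq: "\<bar>fst a\<bar> * \<bar>fst b\<bar> = \<bar>fst c\<bar>"
  have ab: "snd a = - fst a" "snd b = - fst b" "snd c = - fst c" using assms by (auto simp: diag_iff)
  show "mul_rel a b c"
  proof (cases "fst a = 0")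
    case True
    then show ?thesis using eq ab by (auto simp: mul_rel_def prod_eq_iff)
  next
    case False
    \<comment> \<open>This sign gives \<open>?w\<close> coordinates of opposite signs, as
      \<open>M_I\<close> demands; \<open>?y\<close> is the multiple of \<open>?w\<close> by
      \<open>\<epsilon> * fst b\<close>.\<close>
    define \<epsilon> where "\<epsilon> = sgn (fst a)"
    have e: "\<epsilon> = 1 \<or> \<epsilon> = -1" using False by (auto simp: \<epsilon>_def sgn_if)
    let ?u = "(\<epsilon>, - \<epsilon>)" and ?w = "(fst a, - \<epsilon>)" and ?c = "(\<epsilon> * fst b * fst a, - (\<epsilon> * fst b * fst a))"
    let ?y = "(\<epsilon> * fst b * fst a, \<epsilon> * fst b * (- \<epsilon>))"
    have "quad ?w" using False by (auto simp: quad_iff \<epsilon>_def sgn_if)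
    then have "M ?w ?y" using M_I[of ?w "\<epsilon> * fst b"] by simp
    moreover have "qunit ?u" using e by (auto simp: qunit_iff)
    moreover have "\<bar>fst c\<bar> = \<bar>\<epsilon> * fst b * fst a\<bar>" using eq e by (auto simp: abs_mult mult.commute)
    then have "eq_up_to_sign c ?c" using ab by (subst eq_up_to_sign_iff) auto
    moreover have "axis (0, 1)" "(0, 1) \<noteq> (0 :: int \<times> int)" by (auto simp: axis_iff zero_prod_def)
    moreover have "along (0, 1) (?w - a)" "across (0, 1) (?w - ?u)" "along (0, 1) (?y - ?c)"
      "across (0, 1) (?y - b)" using e ab by (auto simp: along_across_vertical)
    ultimately show ?thesis unfolding mul_rel_def by blast
  qed
qed

section \<open>Definability of the plane relations and the interpretation\<close>

lemma definable_via_Ex: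
  assumes "D (\<lambda>e. P (e 0) (\<lambda>i. e (Suc i)))" shows "D (\<lambda>e. \<exists>z. P z e)"
  using definable_via_ex[of P, OF assms] by simp

lemma definable_via_All:
  assumes "D (\<lambda>e. P (e 0) (\<lambda>i. e (Suc i)))" shows "D (\<lambda>e. \<forall>z. P z e)"
  using definable_via_all[of P, OF assms] by simp

lemma definable_term_plus: "definable_term s \<Longrightarrow> definable_term t \<Longrightarrow> definable_term (\<lambda>e. s e + t e)"
  by (rule definable_term_op[OF definable_via_plus]) auto

lemma definable_term_minus: "definable_term s \<Longrightarrow> definable_term t \<Longrightarrow> definable_term (\<lambda>e. s e - t e)"
proof (rule definable_term_op[where f = "\<lambda>a b. a - b"])
  have "D (\<lambda>e. e 0 = e 2 + e 1)"
    using definable_via_ren[OF definable_via_plus, of "case_nat 2 (case_nat 1 (\<lambda>i. 0))"] by (simp add: numeral_2_eq_2)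
  then show "D (\<lambda>e. e 2 = e 0 - e 1)" by (simp add: eq_diff_eq eq_commute)
qed auto

lemma definable_term_zero: "definable_term (\<lambda>e. 0)"
proof -
  have "D (\<lambda>e. e 0 = e 0 + e 0)" using definable_via_ren[OF definable_via_plus, of "\<lambda>i. 0"] by simp
  then show ?thesis by (simp add: definable_term_def)
qed

lemmas definable_via_rules0 = definable_via_Ex definable_via_All definable_via_conj definable_via_disj definable_via_imp definable_via_not definable_via_equal
  definable_term_plus definable_term_minus definable_term_zero definable_term_var definable_via_app1[OF definable_via_quad0] definable_via_app2[OF definable_via_M0]

lemma definable_via_samesign: "definable_term s \<Longrightarrow> definable_term t \<Longrightarrow> D (\<lambda>e. samesign (s e) (t e))"
  by (rule definable_via_app2[where R = samesign]) (unfold samesign_def, intro definable_via_rules0)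

lemma definable_via_qcone: "definable_term s \<Longrightarrow> definable_term t \<Longrightarrow> D (\<lambda>e. qcone (s e) (t e))"
  by (rule definable_via_app2[where R = qcone]) (unfold qcone_def, intro definable_via_rules0 definable_via_samesign)

lemma definable_via_qunit: "definable_term s \<Longrightarrow> D (\<lambda>e. qunit (s e))"
  by (rule definable_via_app1[where R = qunit]) (unfold qunit_def, intro definable_via_rules0 definable_via_samesign definable_via_qcone)

lemma definable_via_axis: "definable_term s \<Longrightarrow> D (\<lambda>e. axis (s e))"
  by (rule definable_via_app1[where R = axis]) (unfold axis_def, intro definable_via_rules0 definable_via_qcone)

lemma definable_via_along: "definable_term s \<Longrightarrow> definable_term t \<Longrightarrow> D (\<lambda>e. along (s e) (t e))"
  by (rule definable_via_app2[where R = along]) (unfold along_def, intro definable_via_rules0 definable_via_axis)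

lemma definable_via_across: "definable_term s \<Longrightarrow> definable_term t \<Longrightarrow> D (\<lambda>e. across (s e) (t e))"
  by (rule definable_via_app2[where R = across]) (unfold across_def, intro definable_via_rules0 definable_via_axis)

lemma definable_via_eq_up_to_sign: "definable_term s \<Longrightarrow> definable_term t \<Longrightarrow> D (\<lambda>e. eq_up_to_sign (s e) (t e))"
  by (rule definable_via_app2[where R = eq_up_to_sign]) (unfold eq_up_to_sign_def, intro definable_via_rules0)

lemma definable_via_diag: "definable_term s \<Longrightarrow> D (\<lambda>e. diag (s e))"
  by (rule definable_via_app1[where R = diag]) (unfold diag_def, intro definable_via_rules0 definable_via_qunit)

lemma definable_via_add_rel: "D (\<lambda>e. add_rel (e i) (e j) (e k))"
  unfolding add_rel_def by (intro definable_via_rules0 definable_via_eq_up_to_sign definable_via_samesign)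

lemma definable_via_mul_rel: "D (\<lambda>e. mul_rel (e i) (e j) (e k))"
  unfolding mul_rel_def by (intro definable_via_rules0 definable_via_eq_up_to_sign definable_via_qunit definable_via_axis definable_via_along definable_via_across)

text \<open>The interpretation is one-dimensional: \<open>E\<close> holds the elements with
  antidiagonal value, and \<open>f\<close> forgets the sign.\<close>

lemma interprets_arith: "interprets_arith G m"
proof -
  define E where "E = {[x] |x. x \<in> G \<and> diag (v x)}"
  define f where "f xs = nat \<bar>fst (v (hd xs))\<bar>" for xs
  have "f ` E = UNIV"
  proof -
    have "n \<in> f ` E" for n
    proof -
      have "(int n, - int n) \<in> v ` G" using W by simp
      then obtain x where x: "x \<in> G" "v x = (int n, - int n)" by (auto simp: image_iff)
      then have "[x] \<in> E" "f [x] = n" by (auto simp: E_def f_def diag_iff)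
      then show ?thesis by (metis image_eqI)
    qed
    then show ?thesis by auto
  qed
  moreover have "definable0 G m 1 E"
  proof (rule definable_via_imp_definable0)
    show "definable_via G m (\<lambda>x. x) (\<lambda>e. diag (v (e 0)))"
      using definable_via_diag[OF definable_term_var, of 0] unfolding definable_via_id_iff[of _ _ v] .
    fix e xs assume "range e \<subseteq> G" "set xs \<subseteq> G" "length xs = 1" "\<And>i. i < 1 \<Longrightarrow> e i = xs ! i"
    then show "diag (v (e 0)) \<longleftrightarrow> xs \<in> E" by (cases xs) (auto simp: E_def)
  qed simp
  moreover have "definable0 G m 2 {xs @ ys |xs ys. xs \<in> E \<and> ys \<in> E \<and> f xs = f ys}"
  proof (rule definable_via_imp_definable0)
    show "definable_via G m (\<lambda>x. x) (\<lambda>e. diag (v (e 0)) \<and> diag (v (e 1)) \<and> eq_up_to_sign (v (e 0)) (v (e 1)))"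
      using definable_via_conj[OF definable_via_diag[OF definable_term_var] definable_via_conj[OF definable_via_diag[OF definable_term_var] definable_via_eq_up_to_sign[OF definable_term_var definable_term_var]], of 0 1 0 1]
      unfolding definable_via_id_iff[of _ _ v] .
    fix e xs assume a: "range e \<subseteq> G" "set xs \<subseteq> G" "length xs = 2" "\<And>i. i < 2 \<Longrightarrow> e i = xs ! i"
    then obtain x y where xs: "xs = [x, y]" by (auto simp: numeral_2_eq_2 length_Suc_conv)
    have "[x, y] \<in> {xs @ ys |xs ys. xs \<in> E \<and> ys \<in> E \<and> f xs = f ys} \<longleftrightarrow> [x] \<in> E \<and> [y] \<in> E \<and> f [x] = f [y]"
      (is "_ \<in> ?S \<longleftrightarrow> ?P")
    proof
      show "?P \<Longrightarrow> [x, y] \<in> ?S" by (intro CollectI exI[of _ "[x]"] exI[of _ "[y]"]) simp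
    qed (auto simp: E_def)
    moreover have "e 0 = x" "e 1 = y" using a(4)[of 0] a(4)[of 1] xs by auto
    ultimately show "diag (v (e 0)) \<and> diag (v (e 1)) \<and> eq_up_to_sign (v (e 0)) (v (e 1)) \<longleftrightarrow>
        xs \<in> {xs @ ys |xs ys. xs \<in> E \<and> ys \<in> E \<and> f xs = f ys}"
      using a(2) xs by (auto simp: E_def f_def diag_iff eq_up_to_sign_iff)
  qed simp
  \<comment> \<open>Addition and multiplication are treated at once: \<open>h\<close> is the
    operation on natural numbers and \<open>R\<close> its counterpart on antidiagonal
    values.\<close>
  moreover have "definable0 G m 3 {xs @ ys @ zs |xs ys zs. xs \<in> E \<and> ys \<in> E \<and> zs \<in> E \<and> h (f xs) (f ys) = f zs}"
    if R: "D (\<lambda>e. R (e 0) (e 1) (e 2))"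
      "\<And>a b c. \<lbrakk>diag a; diag b; diag c\<rbrakk> \<Longrightarrow>
         R a b c \<longleftrightarrow> h (nat \<bar>fst a\<bar>) (nat \<bar>fst b\<bar>) = nat \<bar>fst c\<bar>" for R h
  proof (rule definable_via_imp_definable0)
    show "definable_via G m (\<lambda>x. x) (\<lambda>e. diag (v (e 0)) \<and> diag (v (e 1)) \<and> diag (v (e 2)) \<and> R (v (e 0)) (v (e 1)) (v (e 2)))"
      using definable_via_conj[OF definable_via_diag[OF definable_term_var] definable_via_conj[OF definable_via_diag[OF definable_term_var] definable_via_conj[OF definable_via_diag[OF definable_term_var] R(1)]], of 0 1 2]
      unfolding definable_via_id_iff[of _ _ v] .
    fix e xs assume a: "range e \<subseteq> G" "set xs \<subseteq> G" "length xs = 3" "\<And>i. i < 3 \<Longrightarrow> e i = xs ! i"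
    then obtain x y z where xs: "xs = [x, y, z]" by (auto simp: numeral_3_eq_3 length_Suc_conv)
    have "[x, y, z] \<in> {xs @ ys @ zs |xs ys zs. xs \<in> E \<and> ys \<in> E \<and> zs \<in> E \<and> h (f xs) (f ys) = f zs} \<longleftrightarrow>
        [x] \<in> E \<and> [y] \<in> E \<and> [z] \<in> E \<and> h (f [x]) (f [y]) = f [z]" (is "_ \<in> ?S \<longleftrightarrow> ?P")
    proof
      show "?P \<Longrightarrow> [x, y, z] \<in> ?S" by (intro CollectI exI[of _ "[x]"] exI[of _ "[y]"] exI[of _ "[z]"]) simp
    qed (auto simp: E_def)
    moreover have "e 0 = x" "e 1 = y" "e 2 = z" using a(4)[of 0] a(4)[of 1] a(4)[of 2] xs by auto
    ultimately show "diag (v (e 0)) \<and> diag (v (e 1)) \<and> diag (v (e 2)) \<and> R (v (e 0)) (v (e 1)) (v (e 2)) \<longleftrightarrow>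
        xs \<in> {xs @ ys @ zs |xs ys zs. xs \<in> E \<and> ys \<in> E \<and> zs \<in> E \<and> h (f xs) (f ys) = f zs}"
      using a(2) xs by (auto simp: E_def f_def R(2))
  qed simp
  note triple = this
  moreover have "definable0 G m 3 {xs @ ys @ zs |xs ys zs. xs \<in> E \<and> ys \<in> E \<and> zs \<in> E \<and> f xs + f ys = f zs}"
  proof (rule triple[where R = add_rel])
    fix a b c assume "diag a" "diag b" "diag c"
    then show "add_rel a b c \<longleftrightarrow> nat \<bar>fst a\<bar> + nat \<bar>fst b\<bar> = nat \<bar>fst c\<bar>"
      by (auto simp: add_rel_iff diag_iff simp flip: nat_add_distrib)
  qed (rule definable_via_add_rel)
  moreover have "definable0 G m 3 {xs @ ys @ zs |xs ys zs. xs \<in> E \<and> ys \<in> E \<and> zs \<in> E \<and> f xs * f ys = f zs}"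
  proof (rule triple[where R = mul_rel])
    fix a b c assume "diag a" "diag b" "diag c"
    then show "mul_rel a b c \<longleftrightarrow> nat \<bar>fst a\<bar> * nat \<bar>fst b\<bar> = nat \<bar>fst c\<bar>"
      by (simp add: mul_rel_iff eq_nat_nat_iff flip: nat_mult_distrib)
  qed (rule definable_via_mul_rel)
  moreover have "E \<subseteq> {xs. length xs = 1 \<and> set xs \<subseteq> G}" by (auto simp: E_def)
  ultimately show ?thesis unfolding interprets_arith_def
    by (intro exI[of _ 1] exI[of _ E] exI[of _ f]) simp
qed

end

section \<open>Piecewise affine homeomorphisms\<close>

text \<open>Supplies the increasing sequence of breakpoints that \<open>in_V\<close> demands,
  starting from a mere finite set.\<close>

lemma finite_set_enumerate:
  fixes S :: "real set"
  assumes "finite S" "lo \<in> S" "hi \<in> S" "S \<subseteq> {lo..hi}"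
  obtains q m where "q 0 = lo" "q m = hi" "strict_mono_on {..m} q" "q ` {..m} = S"
    "\<And>i. i < m \<Longrightarrow> {q i<..<q (Suc i)} \<inter> S = {}"
proof -
  define xs where "xs = sorted_list_of_set S"
  define m where "m = length xs - 1"
  have set: "set xs = S" and sorted: "sorted_wrt (<) xs"
    using assms(1) by (auto simp: xs_def)
  then have ne: "xs \<noteq> []" using assms(2) by auto
  then have len: "i < length xs \<longleftrightarrow> i \<le> m" for i
    by (cases xs) (auto simp: m_def)
  have less: "xs ! i < xs ! j" if "i < j" "j \<le> m" for i j
    using sorted_wrt_nth_less[OF sorted] that len by auto
  have lei: "xs ! i \<le> xs ! j" if "i \<le> j" "j \<le> m" for i j
    using less[of i j] that by (cases "i = j") auto
  have img: "(!) xs ` {..m} = S"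
    using set len by (auto simp: set_conv_nth)
  have "xs ! 0 = lo"
  proof -
    obtain i where "i \<le> m" "lo = xs ! i" using img assms(2) by (auto simp: image_iff)
    moreover have "xs ! 0 \<in> S" using img by auto
    ultimately show ?thesis using lei[of 0 i] assms(4) by (force simp: subset_iff)
  qed
  moreover have "xs ! m = hi"
  proof -
    obtain i where "i \<le> m" "hi = xs ! i" using img assms(3) by (auto simp: image_iff)
    moreover have "xs ! m \<in> S" using img by auto
    ultimately show ?thesis using lei[of i m] assms(4) by (force simp: subset_iff)
  qed
  moreover have "strict_mono_on {..m} ((!) xs)"
    using less by (auto intro!: strict_mono_onI)
  moreover have "{xs ! i<..<xs ! Suc i} \<inter> S = {}" if "i < m" for i
  proof (rule ccontr)
    assume "\<not> ?thesis"
    then obtain j where "j \<le> m" "xs ! i < xs ! j" "xs ! j < xs ! Suc i"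
      using img by (auto simp: image_iff)
    with lei[of j i] lei[of "Suc i" j] that show False by (cases "j \<le> i") auto
  qed
  ultimately show ?thesis using img that by blast
qed

text \<open>All slopes are powers of one \<open>p > 1\<close> and can be recorded by integer
  exponents.\<close>

locale pl_group =
  fixes r p :: real and A :: "real set"
  assumes r_pos: "r > 0" and p_gt1: "p > 1"
    and A_zero: "0 \<in> A" and A_add: "a \<in> A \<Longrightarrow> b \<in> A \<Longrightarrow> a + b \<in> A"
    and A_uminus: "a \<in> A \<Longrightarrow> - a \<in> A" and r_in_A: "r \<in> A"
    and A_powi: "a \<in> A \<Longrightarrow> p powi k * a \<in> A"
begin

lemma A_diff: "a \<in> A \<Longrightarrow> b \<in> A \<Longrightarrow> a - b \<in> A"
  using A_add[of a "- b"] A_uminus by simp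

lemma p_neq0 [simp]: "p \<noteq> 0"
  using p_gt1 by linarith

lemma powi_pos [simp]: "p powi k > 0"
  using p_gt1 by simp

lemma powi_neq0 [simp]: "p powi k \<noteq> 0"
  using powi_pos[of k] by linarith

lemma powi_less_iff [simp]: "p powi k < p powi l \<longleftrightarrow> k < l"
  using power_int_strict_increasing[of k l p] power_int_strict_increasing[of l k p] p_gt1
  by (cases k l rule: linorder_cases) auto

lemma powi_eq_iff [simp]: "p powi k = p powi l \<longleftrightarrow> k = l"
  using powi_less_iff[of k l] powi_less_iff[of l k] by (metis less_irrefl linorder_cases)

lemma powi_add: "p powi (k + l) = p powi k * p powi l"
  using p_gt1 by (simp add: power_int_add)

definition affine_on_Icc :: "(real \<Rightarrow> real) \<Rightarrow> real \<Rightarrow> real \<Rightarrow> int \<Rightarrow> bool" where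
  "affine_on_Icc x a b k \<longleftrightarrow> (\<forall>u\<in>{a..b}. x u = x a + p powi k * (u - a))"

lemma affine_on_IccD: "affine_on_Icc x a b k \<Longrightarrow> a \<le> u \<Longrightarrow> u \<le> b \<Longrightarrow> x u = x a + p powi k * (u - a)"
  unfolding affine_on_Icc_def Ball_def atLeastAtMost_iff by blast

lemma affine_on_IccI: "(\<And>u. a \<le> u \<Longrightarrow> u \<le> b \<Longrightarrow> x u = x a + p powi k * (u - a)) \<Longrightarrow> affine_on_Icc x a b k"
  unfolding affine_on_Icc_def Ball_def atLeastAtMost_iff by blast

text \<open>Quantifying over all intervals that miss \<open>P\<close> makes the property stable
  under enlarging \<open>P\<close> and avoids enumerating breakpoints. As the pieces are closed
  intervals, continuity is built in.\<close>

definition PL :: "(real \<Rightarrow> real) \<Rightarrow> real set \<Rightarrow> bool" where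
  "PL x P \<longleftrightarrow> (\<forall>a b. a < b \<longrightarrow> {a<..<b} \<inter> P = {} \<longrightarrow> (\<exists>k. affine_on_Icc x a b k))"

lemma PLD: "PL x P \<Longrightarrow> a < b \<Longrightarrow> {a<..<b} \<inter> P = {} \<Longrightarrow> \<exists>k. affine_on_Icc x a b k"
  unfolding PL_def by blast

text \<open>A working copy of the group: elements fix 0 by definition and carry no condition on the
  images of breakpoints, which \<open>F_maps_A\<close> supplies.\<close>

definition F :: "(real \<Rightarrow> real) set" where
  "F = {x. (\<forall>u. u \<notin> {0<..<r} \<longrightarrow> x u = u) \<and> (\<exists>P. finite P \<and> P \<subseteq> A \<and> PL x P)}"

lemma F_outside: "x \<in> F \<Longrightarrow> u \<notin> {0<..<r} \<Longrightarrow> x u = u"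
  by (auto simp: F_def)

lemma F_0 [simp]: "x \<in> F \<Longrightarrow> x 0 = 0" and F_r [simp]: "x \<in> F \<Longrightarrow> x r = r"
  by (auto simp: F_def)

lemma F_partition:
  assumes "x \<in> F" obtains P where "finite P" "P \<subseteq> A" "PL x P"
  using assms by (auto simp: F_def)

text \<open>Induction on the number of points of \<open>P\<close> inside the interval, splitting at
  one of them. The set \<open>I\<close> allows the use on \<open>{0..<r}\<close> before the
  behaviour at \<open>r\<close> is known.\<close>

lemma piecewise_less:
  assumes "finite P"
    and piece: "\<And>a b. \<lbrakk>a \<in> I; b \<in> I; a < b; {a<..<b} \<inter> P = {}\<rbrakk> \<Longrightarrow> \<exists>k. affine_on_Icc x a b k"
    and I: "\<And>a b c. \<lbrakk>a \<in> I; b \<in> I; a < c; c < b\<rbrakk> \<Longrightarrow> c \<in> I"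
  shows "\<lbrakk>a \<in> I; b \<in> I; a < b\<rbrakk> \<Longrightarrow> x a < x b"
proof (induction "card (P \<inter> {a<..<b})" arbitrary: a b rule: less_induct)
  case less
  show ?case
  proof (cases "{a<..<b} \<inter> P = {}")
    case True
    then obtain k where "affine_on_Icc x a b k" using piece less.prems by blast
    from affine_on_IccD[OF this, of b] have "x b = x a + p powi k * (b - a)" using less.prems by simp
    moreover have "p powi k * (b - a) > 0" using less.prems by simp
    ultimately show ?thesis by linarith
  next
    case False
    then obtain q where q: "q \<in> P" "a < q" "q < b" by auto
    then have "q \<in> I" using I less.prems by blast
    have "P \<inter> {a<..<q} \<subset> P \<inter> {a<..<b}" "P \<inter> {q<..<b} \<subset> P \<inter> {a<..<b}" using q by auto
    then have "card (P \<inter> {a<..<q}) < card (P \<inter> {a<..<b})" "card (P \<inter> {q<..<b}) < card (P \<inter> {a<..<b})"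
      using assms(1) by (auto intro!: psubset_card_mono)
    then have "x a < x q" "x q < x b" using less q \<open>q \<in> I\<close> by blast+
    then show ?thesis by linarith
  qed
qed

lemma F_less: assumes "x \<in> F" "a < b" shows "x a < x b"
proof -
  obtain P where "finite P" "P \<subseteq> A" "PL x P" by (rule F_partition[OF assms(1)])
  then show ?thesis using piecewise_less[of P UNIV x a b] assms(2) PLD by auto
qed

lemma F_less_iff [simp]: "x \<in> F \<Longrightarrow> x a < x b \<longleftrightarrow> a < b"
  using F_less[of x a b] F_less[of x b a] by (cases a b rule: linorder_cases) auto

lemma F_le_iff [simp]: "x \<in> F \<Longrightarrow> x a \<le> x b \<longleftrightarrow> a \<le> b"
  using F_less_iff[of x b a] by linarith

lemma F_eq_iff [simp]: "x \<in> F \<Longrightarrow> x a = x b \<longleftrightarrow> a = b"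
  using F_less[of x a b] F_less[of x b a] by (metis less_irrefl linorder_cases)

definition right_slope :: "(real \<Rightarrow> real) \<Rightarrow> real \<Rightarrow> int \<Rightarrow> bool" where
  "right_slope x t k \<longleftrightarrow> (\<exists>e>0. \<forall>u\<in>{t..t+e}. x u = x t + p powi k * (u - t))"

definition left_slope :: "(real \<Rightarrow> real) \<Rightarrow> real \<Rightarrow> int \<Rightarrow> bool" where
  "left_slope x t k \<longleftrightarrow> (\<exists>e>0. \<forall>u\<in>{t-e..t}. x u = x t + p powi k * (u - t))"

lemma affine_on_Icc_right_slope: "affine_on_Icc x a b k \<Longrightarrow> a < b \<Longrightarrow> right_slope x a k"
  unfolding right_slope_def by (intro exI[of _ "b - a"]) (auto intro!: affine_on_IccD)

lemma affine_on_Icc_left_slope: assumes "affine_on_Icc x a b k" "a < b" shows "left_slope x b k"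
proof -
  have "x u = x b + p powi k * (u - b)" if "u \<in> {a..b}" for u
  proof -
    have "x u = x a + p powi k * (u - a)" "x b = x a + p powi k * (b - a)"
      using affine_on_IccD[OF assms(1), of u] affine_on_IccD[OF assms(1), of b] assms that by auto
    then show ?thesis by (simp add: algebra_simps)
  qed
  moreover have "b - (b - a) = a" "b - a > 0" using assms(2) by auto
  ultimately show ?thesis unfolding left_slope_def by metis
qed

lemma F_slopes_exist:
  assumes "x \<in> F" shows "\<exists>k. right_slope x t k" "\<exists>k. left_slope x t k"
proof -
  obtain P where P: "finite P" "P \<subseteq> A" "PL x P" by (rule F_partition[OF assms])
  obtain d where d: "d > 0" "\<And>q. q \<in> P \<Longrightarrow> q \<noteq> t \<Longrightarrow> d \<le> dist t q"
    using finite_set_avoid[OF P(1), of t] by auto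
  have "{t<..<t+d} \<inter> P = {}" "{t-d<..<t} \<inter> P = {}"
    using d(2) by (fastforce simp: dist_real_def)+
  then obtain k l where "affine_on_Icc x t (t+d) k" "affine_on_Icc x (t-d) t l"
    using PLD[OF P(3), of t "t + d"] PLD[OF P(3), of "t - d" t] d(1) by auto
  then have "right_slope x t k" "left_slope x t l" using affine_on_Icc_right_slope[of x t "t + d"] affine_on_Icc_left_slope[of x "t - d" t] d(1) by auto
  then show "\<exists>k. right_slope x t k" "\<exists>k. left_slope x t k" by blast+
qed

lemma F_isCont: assumes "x \<in> F" shows "isCont x t"
proof -
  obtain k l where "right_slope x t k" "left_slope x t l" using F_slopes_exist[OF assms] by blast
  then obtain d e where d: "d > 0" "\<And>u. u \<in> {t..t+d} \<Longrightarrow> x u = x t + p powi k * (u - t)"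
    and e: "e > 0" "\<And>u. u \<in> {t-e..t} \<Longrightarrow> x u = x t + p powi l * (u - t)"
    unfolding right_slope_def left_slope_def by blast
  have "eventually (\<lambda>u. x t + p powi k * (u - t) = x u) (at_right t)"
    unfolding eventually_at_right_field
    by (intro exI[of _ "t + d"]) (use d(1) in \<open>auto intro!: d(2)[symmetric]\<close>)
  moreover have "((\<lambda>u. x t + p powi k * (u - t)) \<longlongrightarrow> x t) (at_right t)"
    by (auto intro!: tendsto_eq_intros)
  ultimately have R: "(x \<longlongrightarrow> x t) (at_right t)" using Lim_transform_eventually by blast
  have "eventually (\<lambda>u. x t + p powi l * (u - t) = x u) (at_left t)"
    unfolding eventually_at_left_field
    by (intro exI[of _ "t - e"]) (use e(1) in \<open>auto intro!: e(2)[symmetric]\<close>)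
  moreover have "((\<lambda>u. x t + p powi l * (u - t)) \<longlongrightarrow> x t) (at_left t)"
    by (auto intro!: tendsto_eq_intros)
  ultimately have "(x \<longlongrightarrow> x t) (at_left t)" using Lim_transform_eventually by blast
  with R show ?thesis unfolding isCont_def by (rule filterlim_split_at[rotated])
qed

lemma F_continuous_on: "x \<in> F \<Longrightarrow> continuous_on S x"
  using F_isCont by (simp add: continuous_at_imp_continuous_on)

lemma F_bij: assumes "x \<in> F" shows "bij x"
proof -
  have "\<exists>u. x u = w" for w
  proof (cases "w \<in> {0<..<r}")
    case True
    then show ?thesis using IVT'[of x 0 w r] assms r_pos F_continuous_on by auto
  next
    case False
    then show ?thesis using F_outside[OF assms] by blast
  qed
  then have "surj x" unfolding surj_def by metis
  moreover have "inj x" using F_eq_iff[OF assms] by (auto intro: injI)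
  ultimately show ?thesis by (simp add: bij_def)
qed

lemma F_inv [simp]: "x \<in> F \<Longrightarrow> inv x (x u) = u" "x \<in> F \<Longrightarrow> x (inv x u) = u"
  using F_bij[of x] by (auto simp: bij_def surj_f_inv_f)

text \<open>Between the last breakpoint \<open>q\<close> below \<open>u\<close> and \<open>u\<close>
  the map is affine with slope a power of \<open>p\<close>, so \<open>x u - x q\<close> lies in
  \<open>A\<close>. Induction on the number of breakpoints below \<open>u\<close> handles
  \<open>x q\<close>; 0 is added to them because \<open>x\<close> is the identity up to
  there.\<close>

lemma F_maps_A: assumes "x \<in> F" "u \<in> A" shows "x u \<in> A"
proof -
  obtain P where P: "finite P" "P \<subseteq> A" "PL x P" by (rule F_partition[OF assms(1)])
  have "x u \<in> A" if "u \<in> A" for u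
    using that
  proof (induction "card {q \<in> insert 0 P. q < u}" arbitrary: u rule: less_induct)
    case less
    show ?case
    proof (cases "u \<le> 0")
      case True
      then show ?thesis using F_outside[OF assms(1), of u] less.prems by auto
    next
      case False
      let ?Q = "\<lambda>u. {q \<in> insert 0 P. q < u}"
      define q where "q = Max (?Q u)"
      have fin: "finite (?Q u)" "?Q u \<noteq> {}" using P(1) False by auto
      have q: "q \<in> insert 0 P" "q < u" using Max_in[OF fin] by (auto simp: q_def)
      then have "?Q q \<subset> ?Q u" by auto
      then have "card (?Q q) < card (?Q u)" using fin by (intro psubset_card_mono) auto
      moreover have "q \<in> A" using q(1) P(2) A_zero by auto
      ultimately have "x q \<in> A" using less.hyps by blast
      have "\<not> s \<le> q \<Longrightarrow> s \<notin> ?Q u" for s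
        using Max_ge[OF fin(1)] by (auto simp: q_def)
      then have "{q<..<u} \<inter> P = {}" by force
      then obtain k where "affine_on_Icc x q u k" using PLD[OF P(3) q(2)] by blast
      from affine_on_IccD[OF this, of u] have "x u = x q + p powi k * (u - q)" using q(2) by simp
      then show ?thesis using A_add \<open>x q \<in> A\<close> A_powi A_diff less.prems \<open>q \<in> A\<close> by auto
    qed
  qed
  then show ?thesis using assms(2) by blast
qed

section \<open>Closure under inversion and composition\<close>

lemma F_inv_closed: assumes "x \<in> F" shows "inv x \<in> F"
proof -
  obtain P where P: "finite P" "P \<subseteq> A" "PL x P" by (rule F_partition[OF assms(1)])
  have "PL (inv x) (x ` P)" unfolding PL_def
  proof (intro allI impI)
    fix a b assume ab: "a < b" "{a<..<b} \<inter> x ` P = {}"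
    define a' b' where "a' = inv x a" and "b' = inv x b"
    have x: "x a' = a" "x b' = b" using assms by (auto simp: a'_def b'_def)
    then have "a' < b'" using ab(1) F_less_iff[OF assms, of a' b'] by simp
    moreover have "{a'<..<b'} \<inter> P = {}"
    proof (rule ccontr)
      assume "\<not> ?thesis"
      then obtain q where "q \<in> P" "a' < q" "q < b'" by auto
      then have "x q \<in> {a<..<b} \<inter> x ` P" using x assms by (auto simp flip: x)
      then show False using ab by blast
    qed
    ultimately obtain k where k: "affine_on_Icc x a' b' k" using PLD[OF P(3)] by blast
    have "inv x u = a' + p powi (- k) * (u - a)" if u: "u \<in> {a..b}" for u
    proof -
      have "a' \<le> inv x u" "inv x u \<le> b'"
        using u assms F_le_iff[OF assms, of a' "inv x u"] F_le_iff[OF assms, of "inv x u" b'] x by auto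
      then have "u = a + p powi k * (inv x u - a')" using affine_on_IccD[OF k, of "inv x u"] x assms by simp
      then have "p powi k * (inv x u - a') = u - a" by linarith
      then have "inv x u - a' = (u - a) / p powi k"
        by (metis nonzero_mult_div_cancel_left powi_neq0)
      then show ?thesis by (simp add: power_int_minus field_simps)
    qed
    then show "\<exists>k. affine_on_Icc (inv x) a b k" unfolding affine_on_Icc_def a'_def by blast
  qed
  moreover have "x ` P \<subseteq> A" "finite (x ` P)" using P F_maps_A[OF assms] by auto
  moreover have "inv x u = u" if "u \<notin> {0<..<r}" for u
    using F_inv(1)[OF assms, of u] F_outside[OF assms that] by simp
  ultimately show ?thesis by (auto simp: F_def)
qed

lemma F_comp_closed: assumes "x \<in> F" "y \<in> F" shows "y \<circ> x \<in> F"
proof -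
  obtain P where P: "finite P" "P \<subseteq> A" "PL x P" by (rule F_partition[OF assms(1)])
  obtain Q where Q: "finite Q" "Q \<subseteq> A" "PL y Q" by (rule F_partition[OF assms(2)])
  have "PL (y \<circ> x) (P \<union> inv x ` Q)" unfolding PL_def
  proof (intro allI impI)
    fix a b assume ab: "a < b" "{a<..<b} \<inter> (P \<union> inv x ` Q) = {}"
    then have "{a<..<b} \<inter> P = {}" by blast
    then obtain k where k: "affine_on_Icc x a b k" using PLD[OF P(3) ab(1)] by blast
    have "{x a<..<x b} \<inter> Q = {}"
    proof (rule ccontr)
      assume "\<not> ?thesis"
      then obtain q where q: "q \<in> Q" "x a < q" "q < x b" by auto
      then have "a < inv x q" "inv x q < b"
        using F_less_iff[OF assms(1), of a "inv x q"] F_less_iff[OF assms(1), of "inv x q" b] assms by auto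
      then show False using ab q by auto
    qed
    moreover have "x a < x b" using ab assms by simp
    ultimately obtain l where l: "affine_on_Icc y (x a) (x b) l" using PLD[OF Q(3)] by blast
    have "(y \<circ> x) u = (y \<circ> x) a + p powi (k + l) * (u - a)" if "u \<in> {a..b}" for u
    proof -
      have "x u \<in> {x a..x b}" using that assms by auto
      then have "y (x u) = y (x a) + p powi l * (x u - x a)" using affine_on_IccD[OF l, of "x u"] by simp
      also have "x u - x a = p powi k * (u - a)" using affine_on_IccD[OF k, of u] that by simp
      finally show ?thesis by (simp add: powi_add)
    qed
    then show "\<exists>k. affine_on_Icc (y \<circ> x) a b k" unfolding affine_on_Icc_def by blast
  qed
  moreover have "inv x ` Q \<subseteq> A" using Q F_maps_A[OF F_inv_closed[OF assms(1)]] by auto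
  moreover have "(y \<circ> x) u = u" if "u \<notin> {0<..<r}" for u
    using F_outside[OF assms(1) that] F_outside[OF assms(2) that] by simp
  ultimately show ?thesis using P Q unfolding F_def by (force intro!: exI[of _ "P \<union> inv x ` Q"])
qed

lemma id_in_F: "id \<in> F"
proof -
  have "PL id {}" by (auto simp: PL_def affine_on_Icc_def intro!: exI[of _ 0])
  then show ?thesis by (auto simp: F_def)
qed

section \<open>Agreement of \<open>F\<close> with \<open>Fgrp\<close>\<close>

lemma F_subset_Fgrp: "F \<subseteq> Fgrp r (range (\<lambda>k::int. p powi k)) A"
proof
  fix x assume x: "x \<in> F"
  obtain P where P: "finite P" "P \<subseteq> A" "PL x P" by (rule F_partition[OF x])
  have "bij_betw x {0..<r} {0..<r}"
  proof (rule bij_betw_imageI)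
    show "inj_on x {0..<r}" using x by (auto intro!: inj_onI)
    have xr: "x u \<in> {0..<r} \<longleftrightarrow> u \<in> {0..<r}" if "x \<in> F" for u x
      using F_le_iff[OF that, of 0 u] F_less_iff[OF that, of u r] that by simp
    show "x ` {0..<r} = {0..<r}"
    proof (intro equalityI subsetI)
      fix w assume "w \<in> x ` {0..<r}"
      then show "w \<in> {0..<r}" using xr[OF x] by blast
    next
      fix w assume "w \<in> {0..<r}"
      then have "inv x w \<in> {0..<r}" using xr[OF F_inv_closed[OF x]] by blast
      then show "w \<in> x ` {0..<r}" using x by (metis F_inv(2) image_eqI)
    qed
  qed
  \<comment> \<open>\<open>in_V\<close> partitions exactly \<open>[0, r]\<close>, so both ends are
    added and breakpoints outside are dropped.\<close>
  define S where "S = {0, r} \<union> (P \<inter> {0..r})"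
  have S: "finite S" "0 \<in> S" "r \<in> S" "S \<subseteq> {0..r}" "S \<subseteq> A"
    using P r_pos A_zero r_in_A by (auto simp: S_def)
  then obtain q m where q: "q 0 = 0" "q m = r" "strict_mono_on {..m} q" "q ` {..m} = S"
    "\<And>i. i < m \<Longrightarrow> {q i<..<q (Suc i)} \<inter> S = {}"
    using finite_set_enumerate by metis
  have "\<exists>l\<in>range (\<lambda>k::int. p powi k). \<exists>b. \<forall>t\<in>{q i..<q (Suc i)}. x t = l * t + b" if i: "i < m" for i
  proof -
    have "q i \<in> S" "q (Suc i) \<in> S" using q(4) i by auto
    then have "{q i<..<q (Suc i)} \<inter> P = {}"
      using q(5)[OF i] S(4) unfolding S_def by fastforce
    moreover have "q i < q (Suc i)" using q(3) i by (auto simp: strict_mono_on_def)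
    ultimately obtain k where "affine_on_Icc x (q i) (q (Suc i)) k" using PLD[OF P(3)] by blast
    then have "x t = p powi k * t + (x (q i) - p powi k * q i)" if "t \<in> {q i..<q (Suc i)}" for t
      using affine_on_IccD[of x "q i" "q (Suc i)" k t] that by (simp add: algebra_simps)
    then show ?thesis by blast
  qed
  moreover have "\<forall>i\<le>m. q i \<in> A \<and> x (q i) \<in> A"
    using q(4) S(5) F_maps_A[OF x] by blast
  ultimately have "\<exists>q m. q 0 = 0 \<and> q m = r \<and> strict_mono_on {..m} q \<and> (\<forall>i\<le>m. q i \<in> A \<and> x (q i) \<in> A) \<and>
      (\<forall>i<m. \<exists>l\<in>range (\<lambda>k::int. p powi k). \<exists>b. \<forall>t\<in>{q i..<q (Suc i)}. x t = l * t + b)"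
    using q by blast
  moreover have "\<forall>t. t \<notin> {0..<r} \<longrightarrow> x t = t" using F_outside[OF x] by auto
  ultimately show "x \<in> Fgrp r (range (\<lambda>k::int. p powi k)) A"
    using \<open>bij_betw x {0..<r} {0..<r}\<close> F_continuous_on[OF x] by (simp add: Fgrp_def Vgrp_def in_V_def)
qed

text \<open>The pieces of \<open>in_V\<close> are half-open while those of \<open>PL\<close> are
  closed. The missing value at the right end of a piece comes from continuity below
  \<open>r\<close>, and from bijectivity at \<open>r\<close> itself.\<close>

lemma Fgrp_subset_F: "Fgrp r (range (\<lambda>k::int. p powi k)) A \<subseteq> F"
proof
  fix x assume "x \<in> Fgrp r (range (\<lambda>k::int. p powi k)) A"
  then obtain q m where bij: "bij_betw x {0..<r} {0..<r}" and out: "\<And>t. t \<notin> {0..<r} \<Longrightarrow> x t = t"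
    and cont: "continuous_on {0..<r} x"
    and q: "q 0 = 0" "q m = r" "strict_mono_on {..m} q" "\<And>i. i \<le> m \<Longrightarrow> q i \<in> A"
    and piece: "\<And>i. i < m \<Longrightarrow> \<exists>k::int. \<exists>b. \<forall>t\<in>{q i..<q (Suc i)}. x t = p powi k * t + b"
    unfolding Fgrp_def Vgrp_def in_V_def by auto
  define P where "P = q ` {..m}"
  have P: "finite P" "P \<subseteq> A" "0 \<in> P" "r \<in> P" using q by (auto simp: P_def)
  have half: "\<exists>k. \<forall>u\<in>{a..<b}. x u = x a + p powi k * (u - a)"
    if ab: "0 \<le> a" "a < b" "b \<le> r" "{a<..<b} \<inter> P = {}" for a b
  proof -
    define i where "i = Max {j. j \<le> m \<and> q j \<le> a}"
    have fin: "finite {j. j \<le> m \<and> q j \<le> a}" "{j. j \<le> m \<and> q j \<le> a} \<noteq> {}" using q ab by auto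
    have i: "i \<le> m" "q i \<le> a" using Max_in[OF fin] by (auto simp: i_def)
    then have "i < m" using q ab by (cases "i = m") auto
    have "\<not> q (Suc i) \<le> a"
      using Max_ge[OF fin(1), of "Suc i"] \<open>i < m\<close> unfolding i_def[symmetric] by auto
    moreover have "q (Suc i) \<in> P" using \<open>i < m\<close> by (auto simp: P_def)
    ultimately have "b \<le> q (Suc i)" using ab by force
    obtain k b' where kb: "\<And>t. t \<in> {q i..<q (Suc i)} \<Longrightarrow> x t = p powi k * t + b'"
      using piece[OF \<open>i < m\<close>] by blast
    show ?thesis
    proof (intro exI ballI)
      fix u assume "u \<in> {a..<b}"
      then have "u \<in> {q i..<q (Suc i)}" "a \<in> {q i..<q (Suc i)}" using i \<open>b \<le> q (Suc i)\<close> by auto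
      then have "x u = p powi k * u + b'" "x a = p powi k * a + b'" using kb by blast+
      then show "x u = x a + p powi k * (u - a)" by (simp add: algebra_simps)
    qed
  qed
  have closed: "\<exists>k. affine_on_Icc x a b k" if ab: "0 \<le> a" "a < b" "b < r" "{a<..<b} \<inter> P = {}" for a b
  proof -
    obtain k where k: "\<And>u. u \<in> {a..<b} \<Longrightarrow> x u = x a + p powi k * (u - a)"
      using half[of a b] ab by (meson less_imp_le)
    have "continuous_on {a..b} x" using cont ab by (auto elim: continuous_on_subset)
    then have xb: "(x \<longlongrightarrow> x b) (at_left b)"
      using ab by (simp add: continuous_on_Icc_at_leftD)
    have lim: "((\<lambda>u. x a + p powi k * (u - a)) \<longlongrightarrow> x a + p powi k * (b - a)) (at_left b)"
      by (intro tendsto_intros)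
    have "eventually (\<lambda>u. x a + p powi k * (u - a) = x u) (at_left b)"
      unfolding eventually_at_left_field by (intro exI[of _ a]) (use ab in \<open>auto intro!: k[symmetric]\<close>)
    then have "x b = x a + p powi k * (b - a)"
      by (rule tendsto_unique[OF trivial_limit_at_left_real xb Lim_transform_eventually[OF lim]])
    moreover have "x u = x a + p powi k * (u - a)" if "a \<le> u" "u < b" for u by (rule k) (use that in simp)
    ultimately show ?thesis by (intro exI[of _ k] affine_on_IccI) (metis order_le_less)
  qed
  have less: "x a < x b" if "0 \<le> a" "a < b" "b < r" for a b
    by (rule piecewise_less[of P "{0..<r}"]) (use that P closed in auto)
  have rng: "x u \<in> {0..<r}" if "u \<in> {0..<r}" for u using bij that by (auto simp: bij_betw_def)
  have x0: "x 0 = 0"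
  proof -
    have "0 \<in> x ` {0..<r}" using bij r_pos by (simp add: bij_betw_def)
    then obtain u where "u \<in> {0..<r}" "x u = 0" by auto
    then show ?thesis using less[of 0 u] rng[of 0] r_pos by (cases "u = 0") auto
  qed
  \<comment> \<open>The affine formula has limit \<open>w\<close> at \<open>r\<close>. If
    \<open>w < r\<close>, then \<open>w\<close> is attained at some \<open>u < r\<close>, and
    monotonicity pushes later values above \<open>w\<close>, against the formula. If
    \<open>w > r\<close>, the formula takes the value \<open>r\<close> inside
    \<open>[0, r)\<close>.\<close>
  have last: "\<exists>k. affine_on_Icc x a r k" if ab: "0 \<le> a" "a < r" "{a<..<r} \<inter> P = {}" for a
  proof -
    obtain k where k: "\<And>u. u \<in> {a..<r} \<Longrightarrow> x u = x a + p powi k * (u - a)"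
      using half[of a r] ab by blast
    define w where "w = x a + p powi k * (r - a)"
    have "\<not> w < r"
    proof
      assume "w < r"
      moreover have "w \<ge> 0" using rng[of a] ab unfolding w_def
        by (intro add_nonneg_nonneg mult_nonneg_nonneg) (auto intro: less_imp_le)
      ultimately have "w \<in> x ` {0..<r}" using bij by (simp add: bij_betw_def)
      then obtain u where u: "0 \<le> u" "u < r" "x u = w" by auto
      define t where "t = (max u a + r) / 2"
      have t: "u < t" "a < t" "t < r" using u ab by (auto simp: t_def max_def)
      then have "w < x t" using less[of u t] u by simp
      moreover have "x t = x a + p powi k * (t - a)" by (rule k) (use t in simp)
      moreover have "p powi k * (t - a) < p powi k * (r - a)" using t by simp
      ultimately show False unfolding w_def by linarith
    qed
    moreover have "\<not> w > r"
    proof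
      assume w: "w > r"
      define u where "u = a + (r - x a) / p powi k"
      have "x a < r" using rng[of a] ab by auto
      then have "a < u" by (simp add: u_def)
      moreover have "(r - x a) / p powi k < r - a"
      proof -
        have "r - x a < (r - a) * p powi k" using w by (simp add: w_def mult.commute)
        then show ?thesis by (subst pos_divide_less_eq) auto
      qed
      then have "u < r" unfolding u_def by linarith
      moreover have "x a + p powi k * (u - a) = r" by (simp add: u_def)
      ultimately show False using rng[of u] k[of u] ab by auto
    qed
    ultimately have "x r = x a + p powi k * (r - a)" using out[of r] by (simp add: w_def)
    moreover have "x u = x a + p powi k * (u - a)" if "a \<le> u" "u < r" for u by (rule k) (use that in simp)
    ultimately show ?thesis by (intro exI[of _ k] affine_on_IccI) (metis order_le_less)
  qed
  have "PL x P" unfolding PL_def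
  proof (intro allI impI)
    fix a b :: real assume ab: "a < b" "{a<..<b} \<inter> P = {}"
    have "x u = u" if "u \<le> 0 \<or> r \<le> u" for u using out[of u] x0 that by (cases "u = 0") auto
    then have "affine_on_Icc x a b 0" if "b \<le> 0 \<or> r \<le> a" using that ab by (intro affine_on_IccI) auto
    moreover have "0 \<notin> {a<..<b}" "r \<notin> {a<..<b}" using P ab by auto
    ultimately show "\<exists>k. affine_on_Icc x a b k"
      using closed[of a b] last[of a] ab by (cases "b \<le> 0"; cases "r \<le> a"; cases "b = r") auto
  qed
  moreover have "x u = u" if "u \<notin> {0<..<r}" for u using out[of u] x0 that by (cases "u = 0") auto
  ultimately show "x \<in> F" using P by (auto simp: F_def)
qed

lemma Fgrp_eq_F: "Fgrp r (range (\<lambda>k::int. p powi k)) A = F"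
  using F_subset_Fgrp Fgrp_subset_F by blast

section \<open>Germs and iteration\<close>

lemma right_slope_unique: assumes "right_slope x t k" "right_slope x t l" shows "k = l"
proof -
  obtain d e where d: "d > 0" "\<forall>u\<in>{t..t+d}. x u = x t + p powi k * (u - t)"
    and e: "e > 0" "\<forall>u\<in>{t..t+e}. x u = x t + p powi l * (u - t)"
    using assms unfolding right_slope_def by blast
  define u where "u = t + min d e"
  have "u \<in> {t..t+d}" "u \<in> {t..t+e}" "u \<noteq> t" using d(1) e(1) by (auto simp: u_def)
  then have "p powi k * (u - t) = p powi l * (u - t)" using d(2) e(2) by (metis add_left_cancel)
  then show ?thesis using \<open>u \<noteq> t\<close> by simp
qed

lemma right_slope_comp: assumes "right_slope x t k" "right_slope y (x t) l" shows "right_slope (y \<circ> x) t (k + l)"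
proof -
  obtain d e where d: "d > 0" "\<forall>u\<in>{t..t+d}. x u = x t + p powi k * (u - t)"
    and e: "e > 0" "\<forall>u\<in>{x t..x t+e}. y u = y (x t) + p powi l * (u - x t)"
    using assms unfolding right_slope_def by blast
  define f where "f = min d (e / p powi k)"
  have "(y \<circ> x) u = (y \<circ> x) t + p powi (k + l) * (u - t)" if u: "u \<in> {t..t+f}" for u
  proof -
    have "u \<in> {t..t+d}" using u by (auto simp: f_def)
    then have xu: "x u = x t + p powi k * (u - t)" using d(2) by blast
    have "p powi k * (u - t) \<le> p powi k * (e / p powi k)"
      using u by (intro mult_left_mono) (auto simp: f_def less_imp_le)
    moreover have "p powi k * (u - t) \<ge> 0" using u by (intro mult_nonneg_nonneg) (auto simp: less_imp_le)
    ultimately have "x u \<in> {x t..x t+e}" unfolding xu by simp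
    then have "y (x u) = y (x t) + p powi l * (x u - x t)" using e(2) by blast
    also have "x u - x t = p powi k * (u - t)" using xu by simp
    finally show ?thesis by (simp add: powi_add)
  qed
  moreover have "f > 0" using d(1) e(1) by (simp add: f_def)
  ultimately show ?thesis unfolding right_slope_def by blast
qed

text \<open>Conjugation by the reflection \<open>u \<mapsto> - u\<close> exchanges the two sides and
  keeps slopes.\<close>

lemma left_slope_iff_right_slope: "left_slope x t k \<longleftrightarrow> right_slope (\<lambda>u. - x (- u)) (- t) k"
proof -
  have "(\<forall>u\<in>{t-e..t}. x u = x t + p powi k * (u - t)) \<longleftrightarrow>
      (\<forall>u\<in>{-t..-t+e}. - x (- u) = - x (- (- t)) + p powi k * (u - (- t)))" for e
  proof (intro iffI ballI)
    fix u assume "\<forall>u\<in>{t-e..t}. x u = x t + p powi k * (u - t)" "u \<in> {-t..-t+e}"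
    then have "x (- u) = x t + p powi k * (- u - t)" by (elim ballE[of _ _ "- u"]) auto
    then show "- x (- u) = - x (- (- t)) + p powi k * (u - (- t))" by (simp add: algebra_simps)
  next
    fix u assume "\<forall>u\<in>{-t..-t+e}. - x (- u) = - x (- (- t)) + p powi k * (u - (- t))" "u \<in> {t-e..t}"
    then have "- x u = - x t + p powi k * (- u + t)" by (elim ballE[of _ _ "- u"]) auto
    then show "x u = x t + p powi k * (u - t)" by (simp add: algebra_simps)
  qed
  then show ?thesis unfolding left_slope_def right_slope_def by metis
qed

lemma left_slope_unique: "left_slope x t k \<Longrightarrow> left_slope x t l \<Longrightarrow> k = l"
  unfolding left_slope_iff_right_slope by (rule right_slope_unique)

lemma left_slope_comp: assumes "left_slope x t k" "left_slope y (x t) l" shows "left_slope (y \<circ> x) t (k + l)"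
proof -
  have "right_slope ((\<lambda>u. - y (- u)) \<circ> (\<lambda>u. - x (- u))) (- t) (k + l)"
    using assms unfolding left_slope_iff_right_slope by (intro right_slope_comp) auto
  then show ?thesis by (simp add: left_slope_iff_right_slope comp_def)
qed

lemma right_slope_id: "right_slope id t 0" and left_slope_id: "left_slope id t 0"
  by (auto simp: right_slope_def left_slope_def intro!: exI[of _ 1])

lemma right_slope_0_fix: assumes "right_slope x t 0" "x t = t" obtains e where "e > 0" "\<And>u. u \<in> {t..t+e} \<Longrightarrow> x u = u"
  using assms unfolding right_slope_def by auto

lemma left_slope_0_fix: assumes "left_slope x t 0" "x t = t" obtains e where "e > 0" "\<And>u. u \<in> {t-e..t} \<Longrightarrow> x u = u"
  using assms unfolding left_slope_def by auto

lemma right_slope_0I: "e > 0 \<Longrightarrow> (\<And>u. u \<in> {t..t+e} \<Longrightarrow> x u = u) \<Longrightarrow> right_slope x t 0"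
  unfolding right_slope_def by (intro exI[of _ e]) auto

lemma left_slope_0I: "e > 0 \<Longrightarrow> (\<And>u. u \<in> {t-e..t} \<Longrightarrow> x u = u) \<Longrightarrow> left_slope x t 0"
  unfolding left_slope_def by (intro exI[of _ e]) auto

lemma inv_comp_F: "x \<in> F \<Longrightarrow> inv x \<circ> x = id" "x \<in> F \<Longrightarrow> x \<circ> inv x = id"
  by (auto simp: fun_eq_iff)

lemma right_slope_inv: assumes "x \<in> F" "right_slope x t k" shows "right_slope (inv x) (x t) (- k)"
proof -
  obtain j where j: "right_slope (inv x) (x t) j" using F_slopes_exist[OF F_inv_closed[OF assms(1)]] by blast
  have "right_slope id t (k + j)" using right_slope_comp[OF assms(2) j] inv_comp_F[OF assms(1)] by simp
  then show ?thesis using right_slope_unique[OF _ right_slope_id, of t "k + j"] j by (simp add: add_eq_0_iff)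
qed

lemma left_slope_inv: assumes "x \<in> F" "left_slope x t k" shows "left_slope (inv x) (x t) (- k)"
proof -
  obtain j where j: "left_slope (inv x) (x t) j" using F_slopes_exist[OF F_inv_closed[OF assms(1)]] by blast
  have "left_slope id t (k + j)" using left_slope_comp[OF assms(2) j] inv_comp_F[OF assms(1)] by simp
  then show ?thesis using left_slope_unique[OF _ left_slope_id, of t "k + j"] j by (simp add: add_eq_0_iff)
qed

text \<open>The exponents of \<open>c\<close> and \<open>inv c\<close> cancel.\<close>

lemma right_slope_conj:
  assumes "x \<in> F" "c \<in> F" "x t = t" "right_slope x t k" shows "right_slope (c \<circ> x \<circ> inv c) (c t) k"
proof -
  obtain j where j: "right_slope c t j" using F_slopes_exist[OF assms(2)] by blast
  have "right_slope (c \<circ> x) t (k + j)" using right_slope_comp[OF assms(4)] j assms(3) by simp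
  then have "right_slope (c \<circ> x \<circ> inv c) (c t) (- j + (k + j))"
    using right_slope_comp[OF right_slope_inv[OF assms(2) j], of "c \<circ> x" "k + j"] assms(2) by simp
  then show ?thesis by simp
qed

lemma left_slope_conj:
  assumes "x \<in> F" "c \<in> F" "x t = t" "left_slope x t k" shows "left_slope (c \<circ> x \<circ> inv c) (c t) k"
proof -
  obtain j where j: "left_slope c t j" using F_slopes_exist[OF assms(2)] by blast
  have "left_slope (c \<circ> x) t (k + j)" using left_slope_comp[OF assms(4)] j assms(3) by simp
  then have "left_slope (c \<circ> x \<circ> inv c) (c t) (- j + (k + j))"
    using left_slope_comp[OF left_slope_inv[OF assms(2) j], of "c \<circ> x" "k + j"] assms(2) by simp
  then show ?thesis by simp
qed

lemma F_funpow: "x \<in> F \<Longrightarrow> x ^^ n \<in> F"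
  by (induction n) (auto intro: id_in_F F_comp_closed)

lemma funpow_fixed: "x t = t \<Longrightarrow> (x ^^ n) t = t"
  by (induction n) auto

lemma funpow_commute: "(\<And>u. x (y u) = y (x u)) \<Longrightarrow> (x ^^ n) (y u) = y ((x ^^ n) u)"
  by (induction n) auto

lemma inv_commute:
  assumes "x \<in> F" "\<And>u. x (y u) = y (x u)" shows "inv x (y u) = y (inv x u)"
proof -
  have "x (inv x (y u)) = x (y (inv x u))" using assms by simp
  then show ?thesis using assms(1) by simp
qed

lemma right_slope_funpow: "x t = t \<Longrightarrow> right_slope x t k \<Longrightarrow> right_slope (x ^^ n) t (int n * k)"
proof (induction n)
  case (Suc n)
  then have "right_slope (x \<circ> x ^^ n) t (int n * k + k)" using funpow_fixed[of x t n] by (intro right_slope_comp) auto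
  then show ?case by (simp add: algebra_simps comp_def)
qed (use right_slope_id in auto)

lemma left_slope_funpow: "x t = t \<Longrightarrow> left_slope x t k \<Longrightarrow> left_slope (x ^^ n) t (int n * k)"
proof (induction n)
  case (Suc n)
  then have "left_slope (x \<circ> x ^^ n) t (int n * k + k)" using funpow_fixed[of x t n] by (intro left_slope_comp) auto
  then show ?case by (simp add: algebra_simps comp_def)
qed (use left_slope_id in auto)

section \<open>Integer powers\<close>

definition int_pow :: "(real \<Rightarrow> real) \<Rightarrow> int \<Rightarrow> real \<Rightarrow> real" where
  "int_pow x k = (if k \<ge> 0 then x ^^ nat k else inv x ^^ nat (- k))"

lemma int_pow_in_F: "x \<in> F \<Longrightarrow> int_pow x k \<in> F"
  by (simp add: int_pow_def F_funpow F_inv_closed)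

lemma int_pow_commute: "x \<in> F \<Longrightarrow> (\<And>u. x (y u) = y (x u)) \<Longrightarrow> int_pow x k (y u) = y (int_pow x k u)"
  by (auto simp: int_pow_def intro!: funpow_commute inv_commute)

lemma inv_fixed: "x \<in> F \<Longrightarrow> x t = t \<Longrightarrow> inv x t = t"
  using F_inv(1)[of x t] by simp

lemma int_pow_fixed: "x \<in> F \<Longrightarrow> x t = t \<Longrightarrow> int_pow x k t = t"
  by (simp add: int_pow_def funpow_fixed inv_fixed)

lemma right_slope_int_pow: assumes "x \<in> F" "x t = t" "right_slope x t i" shows "right_slope (int_pow x k) t (k * i)"
  using right_slope_funpow[OF assms(2,3), of "nat k"] right_slope_inv[OF assms(1,3)]
    right_slope_funpow[of "inv x" t "- i" "nat (- k)"] inv_fixed[OF assms(1,2)] assms(2)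
  by (auto simp: int_pow_def)

lemma left_slope_int_pow: assumes "x \<in> F" "x t = t" "left_slope x t i" shows "left_slope (int_pow x k) t (k * i)"
  using left_slope_funpow[OF assms(2,3), of "nat k"] left_slope_inv[OF assms(1,3)]
    left_slope_funpow[of "inv x" t "- i" "nat (- k)"] inv_fixed[OF assms(1,2)] assms(2)
  by (auto simp: int_pow_def)

text \<open>Otherwise the iterates decrease to a limit in \<open>[q, u]\<close>, which by continuity
  is a fixed point of \<open>x\<close> inside \<open>(a, b)\<close>.\<close>

lemma iterate_below:
  assumes x: "x \<in> F" and dec: "\<And>u. u \<in> {a<..<b} \<Longrightarrow> x u < u" and u: "u \<in> {a<..<b}" and "a < q"
  shows "\<exists>n. (x ^^ n) u < q"
proof (rule ccontr)
  assume "\<not> ?thesis"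
  then have ge: "q \<le> (x ^^ n) u" for n by (auto simp: not_less)
  define s where "s n = (x ^^ n) u" for n
  have s: "s n \<in> {q..u}" for n
  proof (induction n)
    case (Suc n)
    then have "s n \<in> {a<..<b}" using \<open>a < q\<close> u by auto
    then have "s (Suc n) < s n" using dec by (simp add: s_def)
    then show ?case using Suc ge[of "Suc n"] by (auto simp: s_def)
  qed (use ge[of 0] in \<open>auto simp: s_def\<close>)
  have in_ab: "w \<in> {a<..<b}" if "w \<in> {q..u}" for w using that \<open>a < q\<close> u by auto
  have "decseq s" using dec[OF in_ab[OF s]] by (intro decseq_SucI) (simp add: s_def less_imp_le)
  moreover have "\<forall>n. q \<le> s n" using s by simp
  ultimately obtain L where L: "s \<longlonglongrightarrow> L" by (rule decseq_convergent)
  have "L \<in> {q..u}" using closed_sequentially[OF closed_atLeastAtMost s L] .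
  have "(\<lambda>n. x (s n)) \<longlonglongrightarrow> x L" using F_isCont[OF x] L isCont_tendsto_compose by blast
  moreover have "(\<lambda>n. x (s n)) \<longlonglongrightarrow> L" using LIMSEQ_Suc[OF L] by (simp add: s_def)
  ultimately have "x L = L" using LIMSEQ_unique by blast
  then show False using dec[OF in_ab[OF \<open>L \<in> {q..u}\<close>]] by simp
qed

lemma inv_below:
  assumes "x \<in> F" "w < x w" shows "inv x w < w"
  using F_less_iff[OF assms(1), of "inv x w" w] assms by simp

lemma funpow_inv: assumes "x \<in> F" shows "(x ^^ n) ((inv x ^^ n) w) = w"
proof (induction n arbitrary: w)
  case (Suc n)
  have "(x ^^ Suc n) ((inv x ^^ Suc n) w) = x ((x ^^ n) ((inv x ^^ n) (inv x w)))"
    by (simp add: funpow_swap1)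
  then show ?case using Suc assms by simp
qed simp

text \<open>The inverse decreases points, so some power of it brings \<open>max q u\<close> below
  \<open>u\<close>; pushing forward again gives the claim.\<close>

lemma iterate_above:
  assumes x: "x \<in> F" and inc: "\<And>u. u \<in> {a<..<b} \<Longrightarrow> u < x u" and u: "u \<in> {a<..<b}" and "q < b"
  shows "\<exists>n. q < (x ^^ n) u"
proof -
  have "\<exists>n. (inv x ^^ n) (max q u) < u"
    by (rule iterate_below[of _ a b]) (use inv_below[OF x] inc u \<open>q < b\<close> F_inv_closed[OF x] in auto)
  then obtain n where "(inv x ^^ n) (max q u) < u" by blast
  then have "(x ^^ n) ((inv x ^^ n) (max q u)) < (x ^^ n) u" using F_funpow[OF x] by simp
  then show ?thesis using funpow_inv[OF x] by auto
qed

lemma fixfree_cases: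
  assumes x: "x \<in> F" and free: "\<And>u. u \<in> {a<..<b} \<Longrightarrow> x u \<noteq> u"
  shows "(\<forall>u\<in>{a<..<b}. x u < u) \<or> (\<forall>u\<in>{a<..<b}. u < x u)"
proof (rule ccontr)
  assume "\<not> ?thesis"
  then obtain u w where u: "u \<in> {a<..<b}" "u < x u" and w: "w \<in> {a<..<b}" "x w < w"
    using free by (metis linorder_neqE_linordered_idom)
  have cont: "continuous_on S (\<lambda>t. x t - t)" for S
    using F_continuous_on[OF x] by (intro continuous_intros)
  show False
  proof (cases "u \<le> w")
    case True
    then obtain t where "t \<in> {u..w}" "x t - t = 0"
      using IVT2'[of "\<lambda>t. x t - t" w 0 u] cont u w by auto
    then show False using free[of t] u w by auto
  next
    case False
    then obtain t where "t \<in> {w..u}" "x t - t = 0"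
      using IVT'[of "\<lambda>t. x t - t" w 0 u] cont u w by auto
    then show False using free[of t] u w by auto
  qed
qed

text \<open>A power of \<open>x\<close> carries \<open>u\<close> into the neighbourhood of
  \<open>a\<close> on which \<open>w\<close> is the identity. Since \<open>w\<close> commutes with
  that power, it fixes \<open>u\<close> too.\<close>

lemma commute_trivial_germ_below:
  assumes x: "x \<in> F" and w: "w \<in> F" and comm: "\<And>u. x (w u) = w (x u)" and "x a = a"
    and dec: "\<And>u. u \<in> {a<..<b} \<Longrightarrow> x u < u"
    and e: "e > 0" "\<And>u. u \<in> {a..a+e} \<Longrightarrow> w u = u" and u: "u \<in> {a<..<b}"
  shows "w u = u"
proof -
  obtain n where n: "(x ^^ n) u < a + e" using iterate_below[OF x dec u, of "a + e"] e(1) by auto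
  have "(x ^^ n) a < (x ^^ n) u" using F_funpow[OF x] u by simp
  then have "(x ^^ n) u \<in> {a..a+e}" using n funpow_fixed[of x a, OF \<open>x a = a\<close>] by simp
  then have "(x ^^ n) (w u) = (x ^^ n) u" using e(2) funpow_commute[of x w, OF comm] by simp
  then show ?thesis using F_funpow[OF x] by simp
qed

lemma commute_trivial_germ:
  assumes x: "x \<in> F" and w: "w \<in> F" and comm: "\<And>u. x (w u) = w (x u)" and a: "x a = a" "w a = a"
    and free: "\<And>u. u \<in> {a<..<b} \<Longrightarrow> x u \<noteq> u"
    and "right_slope w a 0" and u: "u \<in> {a<..<b}"
  shows "w u = u"
proof -
  obtain e where e: "e > 0" "\<And>u. u \<in> {a..a+e} \<Longrightarrow> w u = u" using right_slope_0_fix[OF \<open>right_slope w a 0\<close> a(2)] by blast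
  show ?thesis
  proof (cases "\<forall>u\<in>{a<..<b}. x u < u")
    case True
    then show ?thesis using commute_trivial_germ_below[OF x w comm a(1) _ e u] by blast
  next
    case False
    then have "\<forall>u\<in>{a<..<b}. u < x u" using fixfree_cases[OF x free] by blast
    then show ?thesis
      using commute_trivial_germ_below[OF F_inv_closed[OF x] w inv_commute[of x w, OF x comm] inv_fixed[OF x a(1)] _ e u]
        inv_below[OF x] by blast
  qed
qed

lemma right_slope_neq0:
  assumes "x a = a" "a < b" "\<And>u. u \<in> {a<..<b} \<Longrightarrow> x u \<noteq> u" "right_slope x a k" shows "k \<noteq> 0"
proof
  assume "k = 0"
  then obtain e where e: "e > 0" "\<And>u. u \<in> {a..a+e} \<Longrightarrow> x u = u"
    using right_slope_0_fix[of x a] assms(1,4) by blast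
  define u where "u = min (a + e) ((a + b) / 2)"
  have "u \<in> {a<..<b}" "u \<in> {a..a+e}" using e(1) assms(2) by (auto simp: u_def min_def)
  then show False using e(2) assms(3) by blast
qed

text \<open>The combination \<open>w\<close> of powers of \<open>x\<close> and \<open>y\<close> is
  chosen so that its exponent at \<open>a\<close> cancels. It commutes with \<open>x\<close>, hence
  is the identity on the whole interval, and its exponent at \<open>b\<close> must vanish as
  well.\<close>

lemma commute_collinear:
  assumes x: "x \<in> F" and y: "y \<in> F" and comm: "\<And>u. x (y u) = y (x u)"
    and fix_x: "x a = a" "x b = b" and fix_y: "y a = a" "y b = b" and "a < b"
    and free: "\<And>u. u \<in> {a<..<b} \<Longrightarrow> x u \<noteq> u"
    and s: "right_slope x a i" "right_slope y a j" "left_slope x b k" "left_slope y b l"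
  shows "j * k = i * l"
proof -
  define w where "w = int_pow y i \<circ> int_pow x (- j)"
  have wF: "w \<in> F" unfolding w_def using x y by (intro F_comp_closed int_pow_in_F)
  have "right_slope w a (- j * i + i * j)" unfolding w_def
    by (intro right_slope_comp) (use right_slope_int_pow[OF x fix_x(1) s(1), of "- j"] right_slope_int_pow[OF y fix_y(1) s(2)] int_pow_fixed[OF x fix_x(1)] in auto)
  then have "right_slope w a 0" by simp
  moreover have "w a = a" using int_pow_fixed[OF x fix_x(1)] int_pow_fixed[OF y fix_y(1)] by (simp add: w_def)
  moreover have "x (w u) = w (x u)" for u
  proof -
    have "int_pow y i (x u) = x (int_pow y i u)" for u using int_pow_commute[OF y, of x] comm by simp
    moreover have "int_pow x (- j) (x u) = x (int_pow x (- j) u)" for u using int_pow_commute[OF x, of x] by simp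
    ultimately show ?thesis by (simp add: w_def)
  qed
  ultimately have w: "w u = u" if "u \<in> {a<..<b}" for u
    using commute_trivial_germ[OF x wF _ fix_x(1) _ free] that by blast
  have wb: "w b = b" using int_pow_fixed[OF x fix_x(2)] int_pow_fixed[OF y fix_y(2)] by (simp add: w_def)
  have "left_slope w b 0"
  proof (rule left_slope_0I[of "(b - a) / 2"])
    show "(b - a) / 2 > 0" using \<open>a < b\<close> by simp
    fix u assume "u \<in> {b - (b - a) / 2..b}"
    moreover have "b - (b - a) / 2 = (a + b) / 2" by (simp add: field_simps)
    ultimately show "w u = u" using w[of u] wb \<open>a < b\<close> by (cases "u = b") auto
  qed
  moreover have "left_slope w b (- j * k + i * l)" unfolding w_def
    by (intro left_slope_comp) (use left_slope_int_pow[OF x fix_x(2) s(3), of "- j"] left_slope_int_pow[OF y fix_y(2) s(4)] int_pow_fixed[OF x fix_x(2)] in auto)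
  ultimately show ?thesis using left_slope_unique by fastforce
qed

section \<open>Bumps and components\<close>

text \<open>Shrink \<open>r\<close> by a large negative power of \<open>p\<close>.\<close>

lemma A_small:
  assumes "c > 0" obtains g where "g \<in> A" "0 < g" "g < c"
proof -
  obtain n where n: "r / c < p ^ n" using real_arch_pow[OF p_gt1] by blast
  define g where "g = p powi (- int n) * r"
  have g: "g = r / p ^ n" by (simp add: g_def power_int_minus field_simps)
  have pn: "p ^ n > 0" using p_gt1 by simp
  have "g > 0" unfolding g using r_pos pn by simp
  moreover have "r < c * p ^ n" using n assms by (simp add: pos_divide_less_eq mult.commute)
  then have "g < c" unfolding g using pn by (simp add: pos_divide_less_eq)
  moreover have "g \<in> A" using A_powi[OF r_in_A] by (simp add: g_def)
  ultimately show ?thesis using that by blast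
qed

lemma A_of_nat: "g \<in> A \<Longrightarrow> of_nat n * g \<in> A"
  by (induction n) (auto simp: A_zero algebra_simps intro: A_add)

lemma A_dense:
  assumes "0 \<le> a" "a < b" obtains q where "q \<in> A" "a < q" "q < b"
proof -
  obtain g where g: "g \<in> A" "0 < g" "g < b - a" using A_small[of "b - a"] assms by auto
  \<comment> \<open>The first multiple of \<open>g\<close> beyond \<open>a\<close>; it overshoots by
    at most \<open>g < b - a\<close>.\<close>
  define n where "n = nat \<lfloor>a / g\<rfloor> + 1"
  have "a / g < of_nat n" "of_nat n \<le> a / g + 1"
    using assms g by (auto simp: n_def) linarith+
  then have "a < of_nat n * g" "of_nat n * g \<le> a + g" using g(2) by (simp_all add: field_simps)
  then show ?thesis using that[OF A_of_nat[OF g(1), of n]] g(3) by linarith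
qed

text \<open>Three affine pieces suffice: slope \<open>p powi m\<close> near \<open>s\<close>, a
  translation in the middle, slope \<open>p powi (- n)\<close> near \<open>t\<close>.\<close>

lemma bump_exists:
  assumes st: "s \<in> A" "t \<in> A" "0 \<le> s" "s < t" "t \<le> r" and mn: "m > 0" "n > 0"
  obtains x where "x \<in> F" "\<And>u. u \<notin> {s<..<t} \<Longrightarrow> x u = u" "\<And>u. u \<in> {s<..<t} \<Longrightarrow> u < x u"
    "right_slope x s m" "left_slope x t (- n)"
proof -
  define pm pn where "pm = p powi m" and "pn = p powi n"
  have pmn: "pm > 1" "pn > 1"
    using one_less_power_int[OF p_gt1] mn by (auto simp: pm_def pn_def)
  \<comment> \<open>\<open>C * g\<close> will be the joint length of the two outer pieces, so
    \<open>g\<close> is taken below \<open>(t - s) / C\<close> to leave room for the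
    translation.\<close>
  define C where "C = (pn - 1) + pn * (pm - 1)"
  have C: "C > 0" using pmn by (auto simp: C_def intro!: add_pos_pos mult_pos_pos)
  obtain g where g: "g \<in> A" "0 < g" "g < (t - s) / C"
    using A_small[of "(t - s) / C"] C st by auto
  \<comment> \<open>The rise \<open>(pm - 1) * al\<close> over the first piece equals the descent \<open>(1 - 1 / pn) * be\<close> over the last one.\<close>
  define al be d where "al = (pn - 1) * g" and "be = pn * (pm - 1) * g" and "d = (pm - 1) * (pn - 1) * g"
  have pos: "al > 0" "be > 0" "d > 0" using pmn g by (auto simp: al_def be_def d_def)
  have "al + be = C * g" by (simp add: al_def be_def C_def algebra_simps)
  also have "\<dots> < t - s" using g C by (simp add: field_simps)
  finally have sum: "al + be < t - s" .
  have d1: "(pm - 1) * al = d" by (simp add: al_def d_def)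
  have d2: "(1 - 1 / pn) * be = d" using pmn by (simp add: be_def d_def field_simps)
  define x where "x u = u + (if u \<le> s then 0 else if u \<le> s + al then (pm - 1) * (u - s)
    else if u \<le> t - be then d else if u \<le> t then (1 - 1 / pn) * (t - u) else 0)" for u
  have x1: "x u = u" if "u \<le> s" for u using that by (simp add: x_def)
  have x2: "x u = s + pm * (u - s)" if "s \<le> u" "u \<le> s + al" for u
    using that by (auto simp: x_def algebra_simps)
  have x3: "x u = u + d" if "s + al \<le> u" "u \<le> t - be" for u
    using that pos sum d1 by (cases "u = s + al") (auto simp: x_def)
  have x4: "x u = t - (t - u) / pn" if "t - be \<le> u" "u \<le> t" for u
    using that pos sum d2 by (cases "u = t - be") (auto simp: x_def algebra_simps)
  have x5: "x u = u" if "t \<le> u" for u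
    using that pos sum by (cases "u = t") (auto simp: x_def)
  let ?P = "{s, s + al, t - be, t}"
  have a1: "affine_on_Icc x a b 0" if "b \<le> s" for a b
    by (intro affine_on_IccI) (use that x1 in auto)
  have a2: "affine_on_Icc x a b m" if "s \<le> a" "b \<le> s + al" for a b
  proof (rule affine_on_IccI)
    fix u assume "a \<le> u" "u \<le> b"
    then show "x u = x a + p powi m * (u - a)" 
      using x2[of u] x2[of a] that by (simp add: pm_def[symmetric] algebra_simps)
  qed
  have a3: "affine_on_Icc x a b 0" if "s + al \<le> a" "b \<le> t - be" for a b
    by (intro affine_on_IccI) (use that x3 in auto)
  have a4: "affine_on_Icc x a b (- n)" if "t - be \<le> a" "b \<le> t" for a b
  proof (rule affine_on_IccI)
    fix u assume "a \<le> u" "u \<le> b"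
    then show "x u = x a + p powi (- n) * (u - a)" 
      using x4[of u] x4[of a] that by (simp add: power_int_minus pn_def[symmetric] field_simps diff_divide_distrib)
  qed
  have a5: "affine_on_Icc x a b 0" if "t \<le> a" for a b
    by (intro affine_on_IccI) (use that x5 in auto)
  have "PL x ?P" unfolding PL_def
  proof (intro allI impI)
    fix a b :: real assume ab: "a < b" "{a<..<b} \<inter> ?P = {}"
    then have "b \<le> s \<or> s \<le> a" "b \<le> s + al \<or> s + al \<le> a" "b \<le> t - be \<or> t - be \<le> a" "b \<le> t \<or> t \<le> a"
      by (auto simp: not_less)
    then show "\<exists>k. affine_on_Icc x a b k"
      using a1[of b a] a2[of a b] a3[of a b] a4[of a b] a5[of a b] by blast
  qed
  moreover have "al \<in> A" "be \<in> A"
  proof -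
    have "al = pn * g - g" "be = p powi (n + m) * g - pn * g"
      by (simp_all add: al_def be_def powi_add pn_def pm_def algebra_simps)
    then show "al \<in> A" "be \<in> A" using A_diff A_powi g(1) by (auto simp: pn_def)
  qed
  then have "?P \<subseteq> A" using st A_add A_diff by auto
  ultimately have xF: "x \<in> F"
    unfolding F_def using x1 x5 st by (auto intro!: exI[of _ ?P])
  have "u < x u" if u: "u \<in> {s<..<t}" for u
  proof -
    have "(pm - 1) * (u - s) > 0" "(1 - 1 / pn) * (t - u) > 0" using u pmn by auto
    then show ?thesis using pos(3) u by (auto simp: x_def)
  qed
  moreover have "right_slope x s m" using affine_on_Icc_right_slope[OF a2[of s "s + al"]] pos by simp
  moreover have "left_slope x t (- n)" using affine_on_Icc_left_slope[OF a4[of "t - be" t]] pos by simp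
  moreover have "x u = u" if "u \<notin> {s<..<t}" for u using x1 x5 that by force
  ultimately show ?thesis using that xF by blast
qed

lemma moved_inside: "x \<in> F \<Longrightarrow> x t \<noteq> t \<Longrightarrow> t \<in> {0<..<r}"
  using F_outside by blast

text \<open>Take the fixed points nearest to \<open>t\<close> on either side: the fixed points form
  a closed set that contains 0 and \<open>r\<close>.\<close>

lemma component_exists:
  assumes x: "x \<in> F" and t: "x t \<noteq> t"
  obtains a b where "0 \<le> a" "a < t" "t < b" "b \<le> r" "x a = a" "x b = b"
    "\<And>u. u \<in> {a<..<b} \<Longrightarrow> x u \<noteq> u"
proof -
  have t0: "0 < t" "t < r" using moved_inside[OF x t] by auto
  have closed: "closed {u. x u = u}"
    using F_continuous_on[OF x] by (intro closed_Collect_eq continuous_intros)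
  have "0 \<in> {0..t} \<inter> {u. x u = u}" "r \<in> {t..r} \<inter> {u. x u = u}" using x t0 by auto
  then have ne: "{0..t} \<inter> {u. x u = u} \<noteq> {}" "{t..r} \<inter> {u. x u = u} \<noteq> {}" by blast+
  have "compact ({0..t} \<inter> {u. x u = u})"
    using closed by (simp add: compact_Int_closed)
  with ne(1) obtain a where "a \<in> {0..t} \<inter> {u. x u = u}" "\<forall>u\<in>{0..t} \<inter> {u. x u = u}. u \<le> a"
    using compact_attains_sup by blast
  then have a: "a \<in> {0..t}" "x a = a" "\<And>u. u \<in> {0..t} \<Longrightarrow> x u = u \<Longrightarrow> u \<le> a" by auto
  have "compact ({t..r} \<inter> {u. x u = u})"
    using closed by (simp add: compact_Int_closed)
  with ne(2) obtain b where "b \<in> {t..r} \<inter> {u. x u = u}" "\<forall>u\<in>{t..r} \<inter> {u. x u = u}. b \<le> u"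
    using compact_attains_inf by blast
  then have b: "b \<in> {t..r}" "x b = b" "\<And>u. u \<in> {t..r} \<Longrightarrow> x u = u \<Longrightarrow> b \<le> u" by auto
  have "a \<noteq> t" "b \<noteq> t" using a(2) b(2) t by auto
  moreover have "x u \<noteq> u" if "u \<in> {a<..<b}" for u
    using a(1) a(3)[of u] b(1) b(3)[of u] that by (cases "u \<le> t") auto
  ultimately show ?thesis using that[of a b] a b by auto
qed

section \<open>Centralizers fix the ends of components\<close>

lemma right_slope_commute:
  assumes "x \<in> F" "c \<in> F" "\<And>u. x (c u) = c (x u)" "x a = a" "right_slope x a k" shows "right_slope x (c a) k"
proof -
  have "c \<circ> x \<circ> inv c = x" using assms(2) assms(3)[symmetric] by (auto simp: fun_eq_iff)
  then show ?thesis using right_slope_conj[OF assms(1,2,4,5)] by simp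
qed

text \<open>Otherwise the iterates of \<open>a\<close> under \<open>c\<close> are infinitely many fixed points of \<open>x\<close> of slope \<open>\<noteq> 1\<close>, with a breakpoint of \<open>x\<close>
  between any two of them.\<close>
lemma boundary_not_increased:
  assumes x: "x \<in> F" and c: "c \<in> F" and comm: "\<And>u. x (c u) = c (x u)"
    and a: "x a = a" "right_slope x a k" "k \<noteq> 0"
  shows "\<not> a < c a"
proof
  assume less: "a < c a"
  obtain P where P: "finite P" "P \<subseteq> A" "PL x P" by (rule F_partition[OF x])
  define s where "s n = (c ^^ n) a" for n
  have s: "x (s n) = s n" "right_slope x (s n) k" "s n < s (Suc n)" for n
  proof (induction n)
    case (Suc n)
    { case 1 then show ?case using Suc(1) comm by (simp add: s_def) }
    { case 2 then show ?case using right_slope_commute[OF x c comm Suc(1,2)] by (simp add: s_def) }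
    { case 3 then show ?case using Suc(3) c by (simp add: s_def) }
  qed (use a less in \<open>auto simp: s_def\<close>)
  have "\<exists>q\<in>P. s n < q \<and> q < s (Suc n)" for n
  proof (rule ccontr)
    assume "\<not> ?thesis"
    then have "{s n<..<s (Suc n)} \<inter> P = {}" by auto
    then obtain l where l: "affine_on_Icc x (s n) (s (Suc n)) l" using PLD[OF P(3) s(3)] by blast
    then have "l = k" using right_slope_unique[OF affine_on_Icc_right_slope[OF l s(3)] s(2)] by simp
    have "s (Suc n) = s n + p powi k * (s (Suc n) - s n)"
      using affine_on_IccD[OF l, of "s (Suc n)"] s(1) s(3)[of n] \<open>l = k\<close> by simp
    then have "(p powi k - 1) * (s (Suc n) - s n) = 0" by (simp add: algebra_simps)
    then have "p powi k = p powi 0" using s(3)[of n] by simp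
    then show False using a(3) powi_eq_iff by blast
  qed
  then obtain q where q: "\<And>n. q n \<in> P" "\<And>n. s n < q n" "\<And>n. q n < s (Suc n)" by metis
  have "strict_mono q" unfolding strict_mono_Suc_iff using q(2,3) less_trans by blast
  then have "infinite (range q)" using strict_mono_imp_inj_on finite_imageD infinite_UNIV_nat by blast
  then show False using q(1) P(1) finite_subset[of "range q" P] by auto
qed

lemma boundary_fixed:
  assumes x: "x \<in> F" and c: "c \<in> F" and comm: "\<And>u. x (c u) = c (x u)"
    and a: "x a = a" "right_slope x a k" "k \<noteq> 0"
  shows "c a = a"
proof -
  have "x (inv c u) = inv c (x u)" for u using inv_commute[OF c, of x u] comm by simp
  then have "\<not> a < inv c a" using boundary_not_increased[OF x F_inv_closed[OF c] _ a] by blast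
  then have "\<not> c a < a" using F_less_iff[OF c, of a "inv c a"] c by simp
  then show ?thesis using boundary_not_increased[OF x c comm a] by linarith
qed

text \<open>The slope exponent at \<open>a\<close> is nonzero, so \<open>boundary_fixed\<close>
  settles \<open>a\<close>. Then \<open>c b\<close> and \<open>inv c b\<close> are fixed points of
  \<open>x\<close> to the right of \<open>a\<close>, and neither can lie inside the
  component.\<close>

lemma component_fixed:
  assumes x: "x \<in> F" and c: "c \<in> F" and comm: "\<And>u. x (c u) = c (x u)"
    and ab: "x a = a" "x b = b" "a < b" and free: "\<And>u. u \<in> {a<..<b} \<Longrightarrow> x u \<noteq> u"
  shows "c a = a" "c b = b"
proof -
  obtain k where k: "right_slope x a k" using F_slopes_exist[OF x] by blast
  show ca: "c a = a" using boundary_fixed[OF x c comm ab(1) k] right_slope_neq0[OF ab(1,3) free k] by blast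
  have "x (c b) = c b" using comm ab by simp
  moreover have "a < c b" using F_less[OF c ab(3)] ca by simp
  ultimately have "\<not> c b < b" using free[of "c b"] by auto
  moreover have "\<not> b < c b"
  proof
    assume "b < c b"
    have i: "c (inv c b) = b" using c by simp
    have "inv c b < b" "a < inv c b"
      using F_less_iff[OF c, of "inv c b" b] F_less_iff[OF c, of a "inv c b"] i ca ab \<open>b < c b\<close> by auto
    moreover have "c (x (inv c b)) = c (inv c b)" using comm[of "inv c b"] i ab by simp
    then have "x (inv c b) = inv c b" by (simp only: F_eq_iff[OF c])
    ultimately show False using free[of "inv c b"] by auto
  qed
  ultimately show "c b = b" by linarith
qed

lemma commute_disjoint:
  assumes "x \<in> F" "y \<in> F" "\<And>u. x u = u \<or> y u = u" shows "x (y u) = y (x u)"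
proof (cases "x u = u")
  case True
  then show ?thesis using assms(3)[of "y u"] assms(2) by (cases "y u = u") auto
next
  case False
  then have "x (x u) \<noteq> x u" using assms(1) by simp
  then show ?thesis using assms(3)[of "x u"] assms(3)[of u] False by auto
qed

text \<open>The exponent pairs \<open>(1, -1)\<close> and \<open>(1, -2)\<close> are not collinear,
  so \<open>commute_collinear\<close> rules out commutation.\<close>

lemma noncommuting_bumps:
  assumes "s \<in> A" "t \<in> A" "0 \<le> s" "s < t" "t \<le> r"
  obtains x y where "x \<in> F" "y \<in> F" "\<And>u. u \<notin> {s<..<t} \<Longrightarrow> x u = u" "\<And>u. u \<notin> {s<..<t} \<Longrightarrow> y u = u"
    "\<And>u. u \<in> {s<..<t} \<Longrightarrow> u < x u" "\<And>u. u \<in> {s<..<t} \<Longrightarrow> u < y u"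
    "right_slope x s 1" "left_slope x t (-1)" "right_slope y s 1" "left_slope y t (-2)"
proof -
  obtain x where x: "x \<in> F" "\<And>u. u \<notin> {s<..<t} \<Longrightarrow> x u = u" "\<And>u. u \<in> {s<..<t} \<Longrightarrow> u < x u"
    "right_slope x s 1" "left_slope x t (-1)" by (rule bump_exists[OF assms, of 1 1]) auto
  obtain y where y: "y \<in> F" "\<And>u. u \<notin> {s<..<t} \<Longrightarrow> y u = u" "\<And>u. u \<in> {s<..<t} \<Longrightarrow> u < y u"
    "right_slope y s 1" "left_slope y t (-2)" by (rule bump_exists[OF assms, of 1 2]) auto
  show ?thesis using that[OF x(1) y(1) x(2) y(2) x(3) y(3) x(4,5) y(4,5)] .
qed

lemma not_commute_slopes:
  assumes x: "x \<in> F" and y: "y \<in> F" and fixed: "x s = s" "x t = t" "y s = s" "y t = t" and "s < t"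
    and free: "\<And>u. u \<in> {s<..<t} \<Longrightarrow> x u \<noteq> u"
    and "right_slope x s 1" "left_slope x t (-1)" "right_slope y s 1" "left_slope y t (-2)"
  shows "\<not> (\<forall>u. x (y u) = y (x u))"
proof
  assume "\<forall>u. x (y u) = y (x u)"
  then have "(1::int) * (-1) = 1 * (-2)"
    by (intro commute_collinear[OF x y]) (use assms in auto)
  then show False by simp
qed

section \<open>Trivial germs and fixed-point-free elements\<close>

definition commuting :: "(real \<Rightarrow> real) \<Rightarrow> (real \<Rightarrow> real) \<Rightarrow> bool" where
  "commuting x y \<longleftrightarrow> rmul x y = rmul y x"

lemma commuting_iff: "commuting x y \<longleftrightarrow> (\<forall>u. x (y u) = y (x u))"
  by (auto simp: commuting_def rmul_def fun_eq_iff)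

definition nonab_centralizer :: "(real \<Rightarrow> real) \<Rightarrow> bool" where
  "nonab_centralizer z \<longleftrightarrow> (\<exists>x\<in>F. \<exists>y\<in>F. commuting z x \<and> commuting z y \<and> \<not> commuting x y)"

text \<open>With multiplication as the only symbol, the conjugate of \<open>y\<close> by
  \<open>c\<close> is given implicitly as the solution \<open>w = c \<circ> y \<circ> inv c\<close>
  of an equation.\<close>

definition conj_commutes :: "(real \<Rightarrow> real) \<Rightarrow> (real \<Rightarrow> real) \<Rightarrow> (real \<Rightarrow> real) \<Rightarrow> bool" where
  "conj_commutes y z c \<longleftrightarrow> (\<exists>w\<in>F. rmul c w = rmul y c \<and> commuting w z)"

definition flat_ends :: "(real \<Rightarrow> real) \<Rightarrow> bool" where
  "flat_ends y \<longleftrightarrow> (\<forall>z\<in>F. nonab_centralizer z \<longrightarrow> (\<exists>c\<in>F. conj_commutes y z c))"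

text \<open>The inequality expresses that \<open>x\<close> is not the identity, without a constant
  for the latter.\<close>

definition one_bump :: "(real \<Rightarrow> real) \<Rightarrow> bool" where
  "one_bump x \<longleftrightarrow> rmul x x \<noteq> x \<and>
     (\<forall>y\<in>F. \<forall>z\<in>F. flat_ends y \<and> flat_ends z \<longrightarrow> (\<exists>c\<in>F. commuting c x \<and> conj_commutes y z c))"

lemma conj_commutes_iff: assumes "y \<in> F" "c \<in> F" shows "conj_commutes y z c \<longleftrightarrow> commuting (c \<circ> y \<circ> inv c) z"
proof -
  have "rmul c w = rmul y c \<longleftrightarrow> w = c \<circ> y \<circ> inv c" for w
  proof
    assume "rmul c w = rmul y c"
    then have "w (c (inv c u)) = c (y (inv c u))" for u by (simp add: rmul_def fun_eq_iff)
    then show "w = c \<circ> y \<circ> inv c" using assms by (simp add: fun_eq_iff)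
  qed (use assms in \<open>simp add: rmul_def fun_eq_iff\<close>)
  moreover have "c \<circ> y \<circ> inv c \<in> F" using assms by (intro F_comp_closed F_inv_closed)
  ultimately show ?thesis by (auto simp: conj_commutes_def)
qed

text \<open>Let \<open>w\<close> be the commutator of two noncommuting elements that commute with
  \<open>z\<close>. Both fix the left end of each component of \<open>z\<close>, so \<open>w\<close>
  has trivial germ there and is the identity on the component. Hence \<open>z\<close> fixes every
  point moved by \<open>w\<close>, and these form a nonempty open set.\<close>

lemma nonab_centralizer_fixes_interval:
  assumes z: "z \<in> F" and "nonab_centralizer z"
  obtains a b where "0 < a" "a < b" "b < r" "\<And>u. u \<in> {a..b} \<Longrightarrow> z u = u"
proof -
  obtain x y where xy: "x \<in> F" "y \<in> F" "\<And>u. z (x u) = x (z u)" "\<And>u. z (y u) = y (z u)" "\<not> commuting x y"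
    using \<open>nonab_centralizer z\<close> by (auto simp: nonab_centralizer_def commuting_iff)
  define w where "w = inv (y \<circ> x) \<circ> (x \<circ> y)"
  have yx: "y \<circ> x \<in> F" "x \<circ> y \<in> F" using xy F_comp_closed by auto
  then have wF: "w \<in> F" unfolding w_def by (intro F_comp_closed[OF _ F_inv_closed])
  have w: "(y \<circ> x) (w u) = (x \<circ> y) u" for u using F_inv(2)[OF yx(1), of "(x \<circ> y) u"] by (simp add: w_def)
  obtain t where t: "x (y t) \<noteq> y (x t)" using xy(5) by (auto simp: commuting_iff)
  then have wt: "w t \<noteq> t" using w[of t] by auto
  have zw: "z (w u) = w (z u)" for u
  proof -
    have "(y \<circ> x) (z (w u)) = z ((y \<circ> x) (w u))" using xy(3,4) by simp
    also have "\<dots> = (x \<circ> y) (z u)" unfolding w using xy(3,4) by simp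
    also have "\<dots> = (y \<circ> x) (w (z u))" by (simp only: w)
    finally show ?thesis by (simp only: F_eq_iff[OF yx(1)])
  qed
  have fixed: "z u = u" if "w u \<noteq> u" for u
  proof (rule ccontr)
    assume "z u \<noteq> u"
    then obtain a b where ab: "a < u" "u < b" "z a = a" "z b = b" "\<And>u. u \<in> {a<..<b} \<Longrightarrow> z u \<noteq> u"
      using component_exists[OF z] by metis
    have "x a = a" "y a = a" using component_fixed(1)[OF z _ _ ab(3,4) _ ab(5)] xy ab(1,2) by auto
    moreover obtain i j where ij: "right_slope x a i" "right_slope y a j" using F_slopes_exist xy by meson
    ultimately have "right_slope (x \<circ> y) a (j + i)" "right_slope (y \<circ> x) a (i + j)"
      using right_slope_comp[of y a j x i] right_slope_comp[of x a i y j] by auto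
    moreover have "right_slope (inv (y \<circ> x)) ((x \<circ> y) a) (- (i + j))"
      using right_slope_inv[OF yx(1) calculation(2)] \<open>x a = a\<close> \<open>y a = a\<close> by simp
    ultimately have "right_slope w a ((j + i) + - (i + j))" unfolding w_def by - (rule right_slope_comp[of "x \<circ> y"])
    then have "right_slope w a 0" by simp
    moreover have "w a = a" using w[of a] \<open>x a = a\<close> \<open>y a = a\<close> F_eq_iff[OF yx(1), of "w a" a] by simp
    ultimately have "w u = u"
      using commute_trivial_germ[OF z wF zw ab(3) _ ab(5), of b u] ab(1,2) by auto
    then show False using that by blast
  qed
  have "t \<in> {0<..<r}" using moved_inside[OF wF wt] .
  have "open {u. w u \<noteq> u}" using F_continuous_on[OF wF] by (intro open_Collect_neq continuous_intros)
  then have "open ({0<..<r} \<inter> {u. w u \<noteq> u})" by auto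
  then obtain e where e: "e > 0" "cball t e \<subseteq> {0<..<r} \<inter> {u. w u \<noteq> u}"
    using wt \<open>t \<in> {0<..<r}\<close> open_contains_cball by blast
  then have sub: "{t-e..t+e} \<subseteq> {0<..<r} \<inter> {u. w u \<noteq> u}" by (simp add: cball_eq_atLeastAtMost)
  have "t - e \<in> {t-e..t+e}" "t + e \<in> {t-e..t+e}" using e(1) by auto
  then have "t - e \<in> {0<..<r}" "t + e \<in> {0<..<r}" using sub by blast+
  moreover have "z u = u" if "u \<in> {t-e..t+e}" for u using sub that fixed by blast
  ultimately show ?thesis using that[of "t - e" "t + e"] e(1) by auto
qed

text \<open>Two noncommuting bumps supported in the fixed interval commute with
  \<open>z\<close>.\<close>

lemma nonabI:
  assumes z: "z \<in> F" and ab: "0 \<le> a" "a < b" "b \<le> r" and fixed: "\<And>u. u \<in> {a<..<b} \<Longrightarrow> z u = u"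
  shows "nonab_centralizer z"
proof -
  obtain s where s: "s \<in> A" "a < s" "s < b" using A_dense ab by blast
  obtain t where t: "t \<in> A" "s < t" "t < b" using A_dense[of s b] s ab by auto
  have st: "0 \<le> s" "t \<le> r" using s t ab by auto
  obtain x y where xy: "x \<in> F" "y \<in> F"
    "\<And>u. u \<notin> {s<..<t} \<Longrightarrow> x u = u" "\<And>u. u \<notin> {s<..<t} \<Longrightarrow> y u = u"
    "\<And>u. u \<in> {s<..<t} \<Longrightarrow> u < x u" "\<And>u. u \<in> {s<..<t} \<Longrightarrow> u < y u"
    "right_slope x s 1" "left_slope x t (-1)" "right_slope y s 1" "left_slope y t (-2)"
    by (rule noncommuting_bumps[OF s(1) t(1) st(1) t(2) st(2)]) blast
  have "\<not> commuting x y" unfolding commuting_iff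
    by (rule not_commute_slopes[OF xy(1,2) _ _ _ _ t(2) _ xy(7-10)]) (use xy(3,4) xy(5) in force)+
  moreover have "z u = u \<or> x u = u" "z u = u \<or> y u = u" for u
    using fixed[of u] xy(3,4)[of u] s t by (cases "u \<in> {s<..<t}"; auto)+
  then have "commuting z x" "commuting z y" using commute_disjoint[OF z] xy(1,2) unfolding commuting_iff by blast+
  ultimately show ?thesis using xy(1,2) by (auto simp: nonab_centralizer_def)
qed

text \<open>A power of \<open>inv x\<close> first brings \<open>[d, e]\<close> below a point
  \<open>q\<close> of \<open>(a, b)\<close>; then a power of \<open>y\<close>, which fixes
  \<open>q\<close>, pushes everything above \<open>a\<close> without passing
  \<open>q\<close>.\<close>

lemma compress:
  assumes "0 < d" "d \<le> e" "e < r" "0 < a" "a < b" "b < r"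
  obtains c where "c \<in> F" "a < c d" "c e < b"
proof -
  obtain q where q: "q \<in> A" "a < q" "q < b" using A_dense[of a b] assms by auto
  have q0r: "0 < q" "q \<le> r" using q assms by auto
  obtain x where x: "x \<in> F" "\<And>u. u \<in> {0<..<r} \<Longrightarrow> u < x u"
    by (rule bump_exists[OF A_zero r_in_A order_refl r_pos order_refl, of 1 1]) auto
  obtain y where y: "y \<in> F" "\<And>u. u \<in> {0<..<q} \<Longrightarrow> u < y u" "y q = q"
    by (rule bump_exists[OF A_zero q(1) order_refl q0r, of 1 1]) auto
  have "inv x u < u" if "u \<in> {0<..<r}" for u using inv_below[OF x(1) x(2)[OF that]] .
  then obtain n where n: "(inv x ^^ n) e < q"
    using iterate_below[OF F_inv_closed[OF x(1)], of 0 r e q] assms q by auto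
  define f where "f = inv x ^^ n"
  have f: "f \<in> F" unfolding f_def using x by (intro F_funpow F_inv_closed)
  have "f d \<le> f e" using f assms(2) by simp
  then have fd: "0 < f d" "f d < q" using F_less[OF f assms(1)] n F_0[OF f] unfolding f_def by linarith+
  have "\<exists>k. a < (y ^^ k) (f d)"
    by (rule iterate_above[OF y(1), of 0 q]) (use y(2) fd q in auto)
  then obtain k where k: "a < (y ^^ k) (f d)" by blast
  define g where "g = y ^^ k"
  have g: "g \<in> F" unfolding g_def using y by (intro F_funpow)
  have "g (f e) < g q" using g n by (simp add: f_def)
  also have "g q = q" using funpow_fixed[of y q, OF y(3)] by (simp add: g_def)
  finally have "(g \<circ> f) e < b" using q by simp
  moreover have "a < (g \<circ> f) d" using k by (simp add: g_def)
  ultimately show ?thesis using that[of "g \<circ> f"] F_comp_closed[OF f g] by blast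
qed

lemma conj_support:
  assumes "c \<in> F" "\<And>u. u \<notin> {d..e} \<Longrightarrow> y u = u" "u \<notin> {c d..c e}"
  shows "(c \<circ> y \<circ> inv c) u = u"
proof -
  have "inv c u \<notin> {d..e}"
    using F_le_iff[OF assms(1), of d "inv c u"] F_le_iff[OF assms(1), of "inv c u" e] assms by auto
  then show ?thesis using assms(1) assms(2)[of "inv c u"] by simp
qed

section \<open>The slope homomorphism\<close>

definition val :: "(real \<Rightarrow> real) \<Rightarrow> int \<times> int" where
  "val x = (THE k. right_slope x 0 k, THE k. left_slope x r k)"

lemma val_slopes: assumes "x \<in> F" shows "right_slope x 0 (fst (val x))" "left_slope x r (snd (val x))"
proof -
  obtain k l where kl: "right_slope x 0 k" "left_slope x r l" using F_slopes_exist[OF assms] by blast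
  then have "(THE k. right_slope x 0 k) = k" "(THE k. left_slope x r k) = l"
    using right_slope_unique left_slope_unique by (auto intro!: the_equality)
  then show "right_slope x 0 (fst (val x))" "left_slope x r (snd (val x))" using kl by (simp_all add: val_def)
qed

lemma val_eqI: assumes "x \<in> F" "right_slope x 0 k" "left_slope x r l" shows "val x = (k, l)"
  using val_slopes[OF assms(1)] right_slope_unique[OF _ assms(2)] left_slope_unique[OF _ assms(3)]
  by (metis prod.collapse)

lemma val_comp: assumes "x \<in> F" "y \<in> F"
  shows "val (y \<circ> x) = (fst (val x) + fst (val y), snd (val x) + snd (val y))"
  using val_slopes[OF assms(1)] val_slopes[OF assms(2)] assms
  by (intro val_eqI F_comp_closed right_slope_comp left_slope_comp) auto

lemma val_int_pow: assumes "x \<in> F" shows "val (int_pow x n) = (n * fst (val x), n * snd (val x))"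
  using val_slopes[OF assms] assms by (intro val_eqI int_pow_in_F right_slope_int_pow left_slope_int_pow) auto

text \<open>Covering every \<open>d \<le> e\<close> lets one margin serve two elements at a
  time.\<close>

lemma val_0_support:
  assumes x: "x \<in> F" and "val x = (0, 0)"
  obtains e where "e > 0" "\<And>d u. d \<le> e \<Longrightarrow> u \<notin> {d..r-d} \<Longrightarrow> x u = u"
proof -
  have "right_slope x 0 0" "left_slope x r 0" using val_slopes[OF x] assms(2) by auto
  then obtain d e where d: "d > 0" "\<And>u. u \<in> {0..0+d} \<Longrightarrow> x u = u"
    and e: "e > 0" "\<And>u. u \<in> {r-e..r} \<Longrightarrow> x u = u"
    using right_slope_0_fix[of x 0] left_slope_0_fix[of x r] x by (metis F_0 F_r)
  show ?thesis
  proof (rule that[of "min d e"])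
    fix f u assume "f \<le> min d e" "u \<notin> {f..r-f}"
    then show "x u = u" using d(2)[of u] e(2)[of u] F_outside[OF x, of u] by force
  qed (use d(1) e(1) in auto)
qed

text \<open>Near 0 the map is linear with a factor other than 1, so the component of a nearby point
  reaches down to 0.\<close>

lemma component_at_0:
  assumes x: "x \<in> F" and "fst (val x) \<noteq> 0"
  obtains b where "0 < b" "b \<le> r" "x b = b" "\<And>u. u \<in> {0<..<b} \<Longrightarrow> x u \<noteq> u"
proof -
  let ?k = "fst (val x)"
  obtain e where e: "e > 0" "\<forall>u\<in>{0..0+e}. x u = x 0 + p powi ?k * (u - 0)"
    using val_slopes(1)[OF x] unfolding right_slope_def by blast
  have "p powi ?k \<noteq> p powi 0" using assms(2) powi_eq_iff by blast
  then have ne: "x u \<noteq> u" if "u \<in> {0<..e}" for u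
    using bspec[OF e(2), of u] that x by auto
  then obtain a b where "0 \<le> a" "a < e" "e < b" "b \<le> r" "x a = a" "x b = b"
    "\<And>u. u \<in> {a<..<b} \<Longrightarrow> x u \<noteq> u" using component_exists[OF x, of e] e(1) by auto
  moreover from this have "a = 0" using ne[of a] by force
  ultimately show ?thesis using that[of b] e(1) by auto
qed

lemma component_at_r:
  assumes x: "x \<in> F" and "snd (val x) \<noteq> 0"
  obtains a where "0 \<le> a" "a < r" "x a = a" "\<And>u. u \<in> {a<..<r} \<Longrightarrow> x u \<noteq> u"
proof -
  let ?k = "snd (val x)"
  obtain e where e: "e > 0" "\<forall>u\<in>{r-e..r}. x u = x r + p powi ?k * (u - r)"
    using val_slopes(2)[OF x] unfolding left_slope_def by blast
  have "p powi ?k \<noteq> p powi 0" using assms(2) powi_eq_iff by blast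
  then have ne: "x u \<noteq> u" if "u \<in> {r-e..<r}" for u
  proof -
    have "x u - u = (p powi ?k - 1) * (u - r)" using bspec[OF e(2), of u] that x by (simp add: algebra_simps)
    then show ?thesis using \<open>p powi ?k \<noteq> p powi 0\<close> that by auto
  qed
  then obtain a b where "0 \<le> a" "a < r - e" "r - e < b" "b \<le> r" "x a = a" "x b = b"
    "\<And>u. u \<in> {a<..<b} \<Longrightarrow> x u \<noteq> u" using component_exists[OF x, of "r - e"] e(1) by auto
  moreover from this have "b = r" using ne[of b] by force
  ultimately show ?thesis using that[of a] e(1) by auto
qed

text \<open>The conjugate \<open>w\<close> of \<open>y\<close> commutes with \<open>z\<close>, so
  each of the two fixes the ends of the components of the other. Overlapping components must
  therefore coincide, and \<open>commute_collinear\<close> applies on the common interval.\<close>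

lemma overlapping_components:
  assumes F: "y \<in> F" "z \<in> F" "c \<in> F" and "conj_commutes y z c"
    and y: "y a = a" "y b = b" "\<And>u. u \<in> {a<..<b} \<Longrightarrow> y u \<noteq> u" "right_slope y a j" "left_slope y b l"
    and z: "z s = s" "z t = t" "\<And>u. u \<in> {s<..<t} \<Longrightarrow> z u \<noteq> u" "right_slope z s i" "left_slope z t k"
    and over: "c a < t" "s < c b" "a < b" "s < t"
  shows "j * k = i * l"
proof -
  define w where "w = c \<circ> y \<circ> inv c"
  have wF: "w \<in> F" unfolding w_def using F by (intro F_comp_closed F_inv_closed)
  have comm: "z (w u) = w (z u)" "w (z u) = z (w u)" for u
    using \<open>conj_commutes y z c\<close> F unfolding conj_commutes_iff[OF F(1,3)] commuting_iff w_def by auto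
  have wab: "w (c a) = c a" "w (c b) = c b" using F y by (auto simp: w_def)
  have less: "c a < c b" using F over by simp
  have free: "w u \<noteq> u" if "u \<in> {c a<..<c b}" for u
  proof
    assume "w u = u"
    then have "c (y (inv c u)) = c (inv c u)" using F by (simp add: w_def)
    then have "y (inv c u) = inv c u" by (simp only: F_eq_iff[OF F(3)])
    moreover have "inv c u \<in> {a<..<b}"
      using that F F_less_iff[OF F(3), of a "inv c u"] F_less_iff[OF F(3), of "inv c u" b] by simp
    ultimately show False using y(3) by blast
  qed
  have "z (c a) = c a" "z (c b) = c b"
    using component_fixed[OF wF F(2) comm(2) wab less free] by auto
  moreover have wst: "w s = s" "w t = t"
    using component_fixed[OF F(2) wF comm(1) z(1,2) over(4) z(3)] by auto
  ultimately have "c a \<notin> {s<..<t}" "c b \<notin> {s<..<t}" "s \<notin> {c a<..<c b}" "t \<notin> {c a<..<c b}"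
    using free z(3) by blast+
  then have eq: "c a = s" "c b = t" using over less by auto
  have "right_slope w s j" "left_slope w t l"
    using right_slope_conj[OF F(1,3) y(1,4)] left_slope_conj[OF F(1,3) y(2,5)] eq by (auto simp: w_def)
  then show ?thesis
    using commute_collinear[OF F(2) wF comm(1) z(1,2) wst over(4) z(3,4) _ z(5)] by blast
qed

lemma flat_ends_imp_val: assumes y: "y \<in> F" and K: "flat_ends y" shows "val y = (0, 0)"
proof -
  obtain q where q: "q \<in> A" "0 < q" "q < r" using A_dense[of 0 r] r_pos by auto
  have "fst (val y) = 0"
  proof (rule ccontr)
    assume ne: "fst (val y) \<noteq> 0"
    then obtain b where b: "0 < b" "y b = b" "\<And>u. u \<in> {0<..<b} \<Longrightarrow> y u \<noteq> u"
      using component_at_0[OF y] by metis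
    obtain l where l: "left_slope y b l" using F_slopes_exist[OF y] by blast
    \<comment> \<open>This choice makes \<open>l\<close> differ from
      \<open>- N * fst (val y)\<close>, against the collinearity below. The components overlap for
      every \<open>c\<close>, since \<open>c\<close> fixes 0 and both start there.\<close>
    define N where "N = (if l = - fst (val y) then 2 else 1 :: int)"
    obtain z where z: "z \<in> F" "\<And>u. u \<notin> {0<..<q} \<Longrightarrow> z u = u" "\<And>u. u \<in> {0<..<q} \<Longrightarrow> u < z u"
      "right_slope z 0 1" "left_slope z q (- N)"
      by (rule bump_exists[OF A_zero q(1) order_refl q(2) less_imp_le[OF q(3)], of 1 N]) (auto simp: N_def)
    have "nonab_centralizer z" by (rule nonabI[OF z(1), of q r]) (use z(2) q in auto)
    then obtain c where c: "c \<in> F" "conj_commutes y z c" using K z(1) by (auto simp: flat_ends_def)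
    have "0 < c b" using F_less[OF c(1) b(1)] c(1) by simp
    then have "fst (val y) * (- N) = 1 * l"
      by (intro overlapping_components[OF y z(1) c F_0[OF y] b(2,3) val_slopes(1)[OF y] l _ _ _ z(4,5)])
        (use z(2,3) c(1) b(1) q in force)+
    then show False using ne by (auto simp: N_def split: if_splits)
  qed
  moreover have "snd (val y) = 0"
  proof (rule ccontr)
    assume ne: "snd (val y) \<noteq> 0"
    then obtain a where a: "a < r" "y a = a" "\<And>u. u \<in> {a<..<r} \<Longrightarrow> y u \<noteq> u"
      using component_at_r[OF y] by metis
    obtain j where j: "right_slope y a j" using F_slopes_exist[OF y] by blast
    \<comment> \<open>The mirror image of the previous choice, now for components that end at
      \<open>r\<close>.\<close>
    define N where "N = (if j = - snd (val y) then 2 else 1 :: int)"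
    obtain z where z: "z \<in> F" "\<And>u. u \<notin> {q<..<r} \<Longrightarrow> z u = u" "\<And>u. u \<in> {q<..<r} \<Longrightarrow> u < z u"
      "right_slope z q N" "left_slope z r (- 1)"
      by (rule bump_exists[OF q(1) r_in_A less_imp_le[OF q(2)] q(3) order_refl, of N 1]) (auto simp: N_def)
    have "nonab_centralizer z" by (rule nonabI[OF z(1), of 0 q]) (use z(2) q in auto)
    then obtain c where c: "c \<in> F" "conj_commutes y z c" using K z(1) by (auto simp: flat_ends_def)
    have "c a < r" using F_less[OF c(1) a(1)] c(1) by simp
    then have "j * (- 1) = N * snd (val y)"
      by (intro overlapping_components[OF y z(1) c a(2) F_r[OF y] a(3) j val_slopes(2)[OF y] _ _ _ z(4,5)])
        (use z(2,3) c(1) a(1) q in force)+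
    then show False using ne by (auto simp: N_def split: if_splits)
  qed
  ultimately show ?thesis by (simp add: prod_eq_iff)
qed

lemma val_imp_flat_ends: assumes y: "y \<in> F" and v: "val y = (0, 0)" shows "flat_ends y"
  unfolding flat_ends_def
proof (intro ballI impI)
  fix z assume z: "z \<in> F" "nonab_centralizer z"
  obtain a b where ab: "0 < a" "a < b" "b < r" "\<And>u. u \<in> {a..b} \<Longrightarrow> z u = u"
    using nonab_centralizer_fixes_interval[OF z] by metis
  obtain e where e: "e > 0" "\<And>d u. d \<le> e \<Longrightarrow> u \<notin> {d..r-d} \<Longrightarrow> y u = u"
    using val_0_support[OF y v] by metis
  define d where "d = min e (r / 2)"
  have d: "0 < d" "d \<le> r - d" "r - d < r" using e(1) r_pos by (auto simp: d_def min_def)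
  have supp: "y u = u" if "u \<notin> {d..r-d}" for u by (rule e(2)[of d]) (use that in \<open>auto simp: d_def\<close>)
  obtain c where c: "c \<in> F" "a < c d" "c (r - d) < b" using compress[OF d ab(1-3)] by metis
  have "(c \<circ> y \<circ> inv c) u = u \<or> z u = u" for u
    using conj_support[of c d "r - d" y u, OF c(1) supp] c ab(4)[of u] by force
  moreover have "c \<circ> y \<circ> inv c \<in> F" using c(1) y by (intro F_comp_closed F_inv_closed)
  ultimately have "conj_commutes y z c" unfolding conj_commutes_iff[OF y c(1)] commuting_iff using commute_disjoint[OF _ z(1)] by blast
  then show "\<exists>c\<in>F. conj_commutes y z c" using c(1) by blast
qed

lemma flat_ends_iff: "y \<in> F \<Longrightarrow> flat_ends y \<longleftrightarrow> val y = (0, 0)"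
  using flat_ends_imp_val val_imp_flat_ends by blast

text \<open>Both supports lie in some \<open>[d, r - d]\<close>, and a power of \<open>x\<close>,
  which commutes with \<open>x\<close>, moves this interval off itself.\<close>

lemma fixfree_imp_one_bump:
  assumes x: "x \<in> F" and free: "\<And>u. u \<in> {0<..<r} \<Longrightarrow> x u \<noteq> u" shows "one_bump x"
  unfolding one_bump_def
proof (intro conjI ballI impI)
  have half: "r / 2 \<in> {0<..<r}" using r_pos by simp
  show "rmul x x \<noteq> x"
  proof
    assume "rmul x x = x"
    then have "x (x (r / 2)) = x (r / 2)" by (simp add: rmul_def fun_eq_iff)
    then show False using free[OF half] x by simp
  qed
  fix y z assume yz: "y \<in> F" "z \<in> F" "flat_ends y \<and> flat_ends z"
  then have v: "val y = (0, 0)" "val z = (0, 0)" using flat_ends_iff by auto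
  obtain e where e: "e > 0" "\<And>d u. d \<le> e \<Longrightarrow> u \<notin> {d..r-d} \<Longrightarrow> y u = u"
    using val_0_support[OF yz(1) v(1)] by metis
  obtain f where f: "f > 0" "\<And>d u. d \<le> f \<Longrightarrow> u \<notin> {d..r-d} \<Longrightarrow> z u = u"
    using val_0_support[OF yz(2) v(2)] by metis
  define d where "d = min (min e f) (r / 2)"
  have d: "d \<in> {0<..<r}" "r - d \<in> {0<..<r}" "d \<le> e" "d \<le> f"
    using e(1) f(1) r_pos by (auto simp: d_def min_def)
  have "\<exists>n. (x ^^ n) (r - d) < d \<or> r - d < (x ^^ n) d"
  proof -
    from fixfree_cases[OF x free] show ?thesis
    proof
      assume "\<forall>u\<in>{0<..<r}. x u < u"
      then have "\<exists>n. (x ^^ n) (r - d) < d" by (intro iterate_below[OF x, of 0 r]) (use d in auto)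
      then show ?thesis by blast
    next
      assume "\<forall>u\<in>{0<..<r}. u < x u"
      then have "\<exists>n. r - d < (x ^^ n) d" by (intro iterate_above[OF x, of 0 r]) (use d in auto)
      then show ?thesis by blast
    qed
  qed
  then obtain n where n: "(x ^^ n) (r - d) < d \<or> r - d < (x ^^ n) d" by blast
  define c where "c = x ^^ n"
  have c: "c \<in> F" unfolding c_def using x by (rule F_funpow)
  have "(c \<circ> y \<circ> inv c) u = u \<or> z u = u" for u
  proof (cases "u \<in> {d..r-d}")
    case True
    then have "u \<notin> {c d..c (r - d)}" using n by (auto simp: c_def)
    then show ?thesis using conj_support[of c d "r - d" y u, OF c e(2)[OF d(3)]] by blast
  qed (use f(2)[OF d(4)] in blast)
  moreover have "c \<circ> y \<circ> inv c \<in> F" using c yz(1) by (intro F_comp_closed F_inv_closed)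
  ultimately have "conj_commutes y z c" unfolding conj_commutes_iff[OF yz(1) c] commuting_iff using commute_disjoint[OF _ yz(2)] by blast
  moreover have "commuting c x" unfolding commuting_iff c_def using funpow_commute[of x x n] by simp
  ultimately show "\<exists>c\<in>F. commuting c x \<and> conj_commutes y z c" using c by blast
qed

text \<open>If \<open>x\<close> has a fixed point in \<open>(0, r)\<close>, some component of
  \<open>x\<close> has an end \<open>t\<close> in \<open>(0, r)\<close>, and the centralizer of
  \<open>x\<close> fixes \<open>t\<close>. For two noncommuting bumps around \<open>t\<close>,
  conjugation within the centralizer cannot separate their components.\<close>

lemma one_bump_imp_fixfree:
  assumes x: "x \<in> F" and OB: "one_bump x" and u: "u \<in> {0<..<r}" shows "x u \<noteq> u"
proof
  assume xu: "x u = u"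
  have "\<exists>t. x t \<noteq> t"
  proof (rule ccontr)
    assume "\<not> ?thesis"
    then have "rmul x x = x" by (auto simp: rmul_def)
    then show False using OB by (simp add: one_bump_def)
  qed
  then obtain t0 where "x t0 \<noteq> t0" by blast
  then obtain a b where ab: "0 \<le> a" "a < t0" "t0 < b" "b \<le> r" "x a = a" "x b = b"
    "\<And>u. u \<in> {a<..<b} \<Longrightarrow> x u \<noteq> u" using component_exists[OF x] by metis
  have "a < b" using ab by linarith
  have cab: "c a = a" "c b = b" if "c \<in> F" "commuting c x" for c
    using component_fixed[OF x that(1) _ ab(5,6) \<open>a < b\<close> ab(7)] that(2) by (auto simp: commuting_iff)
  \<comment> \<open>If \<open>a = 0\<close>, the component ends before the fixed point
    \<open>u\<close>, so \<open>b < r\<close>.\<close>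
  define t where "t = (if a = 0 then b else a)"
  have ct: "c t = t" if "c \<in> F" "commuting c x" for c using cab[OF that] by (simp add: t_def)
  have t: "0 < t" "t < r"
  proof -
    have "b \<le> u" if "a = 0" using that ab(7)[of u] u xu by force
    then show "0 < t" "t < r" using ab(1-4) u by (auto simp: t_def)
  qed
  obtain s where s: "s \<in> A" "0 < s" "s < t" using A_dense[of 0 t] t by auto
  obtain e where e: "e \<in> A" "t < e" "e < r" using A_dense[of t r] t by auto
  have se: "s < e" "0 \<le> s" "e \<le> r" using s e by auto
  obtain y z where yz: "y \<in> F" "z \<in> F"
    "\<And>u. u \<notin> {s<..<e} \<Longrightarrow> y u = u" "\<And>u. u \<notin> {s<..<e} \<Longrightarrow> z u = u"
    "\<And>u. u \<in> {s<..<e} \<Longrightarrow> u < y u" "\<And>u. u \<in> {s<..<e} \<Longrightarrow> u < z u"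
    "right_slope y s 1" "left_slope y e (-1)" "right_slope z s 1" "left_slope z e (-2)"
    by (rule noncommuting_bumps[OF s(1) e(1) se(2,1,3)]) blast
  have "flat_ends w" if "w \<in> F" "\<And>u. u \<notin> {s<..<e} \<Longrightarrow> w u = u" for w
    using that s e by (intro val_imp_flat_ends val_eqI right_slope_0I[of s] left_slope_0I[of "r - e"]) auto
  then have "flat_ends y" "flat_ends z" using yz by blast+
  then obtain c where c: "c \<in> F" "commuting c x" "conj_commutes y z c" using OB yz(1,2) by (auto simp: one_bump_def)
  have "c s < t" "t < c e" using F_less[OF c(1) s(3)] F_less[OF c(1) e(2)] ct[OF c(1,2)] by auto
  then have "(1::int) * (-2) = 1 * (-1)"
    by (intro overlapping_components[OF yz(1,2) c(1,3) _ _ _ yz(7,8) _ _ _ yz(9,10)])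
      (use yz(3,4) yz(5,6) s e in force)+
  then show False by simp
qed

text \<open>The graph stays on one side of the diagonal, which forces opposite signs of the
  exponents at the two ends.\<close>

lemma fixfree_val_sign:
  assumes x: "x \<in> F" and free: "\<And>u. u \<in> {0<..<r} \<Longrightarrow> x u \<noteq> u"
  shows "fst (val x) * snd (val x) < 0"
proof -
  let ?k = "fst (val x)" and ?l = "snd (val x)"
  obtain d where d: "d > 0" "\<forall>u\<in>{0..0+d}. x u = x 0 + p powi ?k * (u - 0)"
    using val_slopes(1)[OF x] unfolding right_slope_def by blast
  obtain e where e: "e > 0" "\<forall>u\<in>{r-e..r}. x u = x r + p powi ?l * (u - r)"
    using val_slopes(2)[OF x] unfolding left_slope_def by blast
  define h where "h = min (min d e) (r / 2)"
  have h: "0 < h" "h \<le> d" "h \<le> e" "h < r" using d(1) e(1) r_pos by (auto simp: h_def min_def)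
  have in_0r: "h \<in> {0<..<r}" "r - h \<in> {0<..<r}" using h by auto
  have k: "x h = p powi ?k * h" using bspec[OF d(2), of h] h x by simp
  have l: "x (r - h) = r - p powi ?l * h" using bspec[OF e(2), of "r - h"] h x by simp
  have *: "p powi n * h < h \<longleftrightarrow> n < 0" "h < p powi n * h \<longleftrightarrow> 0 < n" for n :: int
    using powi_less_iff[of n 0] powi_less_iff[of 0 n] h(1) by simp_all
  from fixfree_cases[OF x free] show ?thesis
  proof
    assume "\<forall>u\<in>{0<..<r}. x u < u"
    then have "x h < h" "x (r - h) < r - h" using in_0r by blast+
    then have "p powi ?k * h < h" "h < p powi ?l * h" using k l by linarith+
    then show ?thesis unfolding * by (simp add: mult_neg_pos)
  next
    assume "\<forall>u\<in>{0<..<r}. u < x u"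
    then have "h < x h" "r - h < x (r - h)" using in_0r by blast+
    then have "h < p powi ?k * h" "p powi ?l * h < h" using k l by linarith+
    then show ?thesis unfolding * by (simp add: mult_pos_neg)
  qed
qed

lemma fixfree_exists:
  assumes "k * l < 0"
  obtains x where "x \<in> F" "one_bump x" "val x = (k, l)"
proof -
  have *: "\<exists>x\<in>F. one_bump x \<and> val x = (k, l)" if kl: "k > 0" "l < 0" for k l
  proof -
    obtain x where x: "x \<in> F" "\<And>u. u \<notin> {0<..<r} \<Longrightarrow> x u = u" "\<And>u. u \<in> {0<..<r} \<Longrightarrow> u < x u"
      "right_slope x 0 k" "left_slope x r (- (- l))"
      by (rule bump_exists[OF A_zero r_in_A order_refl r_pos order_refl, of k "- l"]) (use kl in auto)
    then have "one_bump x" by (intro fixfree_imp_one_bump) force+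
    then show ?thesis using x val_eqI[OF x(1,4)] by auto
  qed
  consider "k > 0" "l < 0" | "k < 0" "l > 0"
    using assms by (auto simp: mult_less_0_iff)
  then show ?thesis
  proof cases
    case 1
    then show ?thesis using * that by blast
  next
    case 2
    then obtain x where x: "x \<in> F" "one_bump x" "val x = (- k, - l)" using *[of "- k" "- l"] by auto
    have "inv x u \<noteq> u" if "u \<in> {0<..<r}" for u
      using one_bump_imp_fixfree[OF x(1,2) that] x(1) by (metis F_inv(2))
    then have "one_bump (inv x)" by (intro fixfree_imp_one_bump F_inv_closed x(1))
    moreover have "val (inv x) = (k, l)" using val_int_pow[OF x(1), of "-1"] x(3) by (simp add: int_pow_def)
    ultimately show ?thesis using that F_inv_closed[OF x(1)] by blast
  qed
qed

lemma val_surj: "val ` F = UNIV"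
proof -
  have "(k, l) \<in> val ` F" for k l :: int
  proof -
    obtain x where x: "x \<in> F" "val x = (1, -1)" by (rule fixfree_exists[of 1 "-1"]) auto
    obtain y where y: "y \<in> F" "val y = (1, -2)" by (rule fixfree_exists[of 1 "-2"]) auto
    \<comment> \<open>The pairs \<open>(1, -1)\<close> and \<open>(1, -2)\<close> have determinant
      -1 and hence generate all integer pairs.\<close>
    have "val (int_pow x (2 * k + l) \<circ> int_pow y (- k - l)) = (k, l)"
      using x y by (simp add: val_comp int_pow_in_F val_int_pow)
    then show ?thesis using F_comp_closed[OF int_pow_in_F[OF y(1)] int_pow_in_F[OF x(1)]] by (metis image_eqI)
  qed
  then show ?thesis by auto
qed

section \<open>Interpretation\<close>

interpretation G: valued_structure F rmul "\<lambda>x. x" F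
proof
  show "definable_via F rmul (\<lambda>x. x) (\<lambda>e. e 0 = e 1)"
    unfolding definable_via_def by (rule exI[of _ "GEq (GVar 0) (GVar 1)"]) simp
qed simp

lemma definable_via_rmul_eq: "definable_via F rmul (\<lambda>x. x) (\<lambda>e. rmul (e i) (e j) = rmul (e k) (e l))"
  unfolding definable_via_def
  by (rule exI[of _ "GEq (GMul (GVar i) (GVar j)) (GMul (GVar k) (GVar l))"]) simp

lemma definable_via_rmul: "definable_via F rmul (\<lambda>x. x) (\<lambda>e. rmul (e i) (e j) = e k)"
  unfolding definable_via_def by (rule exI[of _ "GEq (GMul (GVar i) (GVar j)) (GVar k)"]) simp

lemmas group_rules = G.definable_via_ex G.definable_via_all G.definable_via_conj G.definable_via_imp G.definable_via_not definable_via_rmul_eq definable_via_rmul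

section \<open>Definability of the group-theoretic properties\<close>

lemma definable_via_commuting: "definable_via F rmul (\<lambda>x. x) (\<lambda>e. commuting (e i) (e j))"
  unfolding commuting_def by (rule definable_via_rmul_eq)

lemma definable_via_nonab_centralizer: "definable_via F rmul (\<lambda>x. x) (\<lambda>e. nonab_centralizer (e i))"
  unfolding nonab_centralizer_def by (intro group_rules definable_via_commuting)

lemma definable_via_cc: "definable_via F rmul (\<lambda>x. x) (\<lambda>e. conj_commutes (e i) (e j) (e k))"
  unfolding conj_commutes_def by (intro group_rules definable_via_commuting)

lemma definable_via_flat_ends: "definable_via F rmul (\<lambda>x. x) (\<lambda>e. flat_ends (e i))"
  unfolding flat_ends_def by (intro group_rules definable_via_nonab_centralizer definable_via_cc)

lemma definable_via_one_bump: "definable_via F rmul (\<lambda>x. x) (\<lambda>e. one_bump (e i))"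
  unfolding one_bump_def by (intro group_rules definable_via_flat_ends definable_via_commuting definable_via_cc)

lemma rmul_closed: "x \<in> F \<Longrightarrow> y \<in> F \<Longrightarrow> rmul x y \<in> F"
  by (simp add: rmul_def F_comp_closed)

lemma val_rmul: "x \<in> F \<Longrightarrow> y \<in> F \<Longrightarrow> val (rmul x y) = val x + val y"
  by (simp add: rmul_def val_comp prod_eq_iff)

text \<open>Two elements have equal values iff they differ by a kernel element, and
  \<open>flat_ends\<close> defines the kernel.\<close>

lemma val_eq_iff:
  assumes "x \<in> F" "y \<in> F" shows "val x = val y \<longleftrightarrow> (\<exists>k\<in>F. flat_ends k \<and> rmul k y = x)"
proof
  assume eq: "val x = val y"
  define k where "k = inv y \<circ> x"
  have k: "k \<in> F" unfolding k_def using assms by (intro F_comp_closed F_inv_closed)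
  have kx: "rmul k y = x" using assms by (simp add: rmul_def k_def fun_eq_iff)
  then have "val k = 0" using val_rmul[OF k assms(2)] eq by simp
  then show "\<exists>k\<in>F. flat_ends k \<and> rmul k y = x" using k kx flat_ends_iff[OF k] by (auto simp: zero_prod_def)
next
  assume "\<exists>k\<in>F. flat_ends k \<and> rmul k y = x"
  then show "val x = val y" using val_rmul assms flat_ends_iff by (auto simp: zero_prod_def[symmetric])
qed

lemma definable_via_val_eq: "definable_via F rmul (\<lambda>x. x) (\<lambda>e. val (e i) = val (e j))"
proof (rule G.definable_via_cong)
  show "definable_via F rmul (\<lambda>x. x) (\<lambda>e. \<exists>k\<in>F. flat_ends k \<and> rmul k (e j) = e i)"
    by (intro group_rules definable_via_flat_ends)
qed (use val_eq_iff in blast)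

text \<open>The relation \<open>M\<close> of the plane: \<open>commute_collinear\<close> gives one
  bound and the powers of \<open>x\<close> the other.\<close>

definition collinear_slopes :: "int \<times> int \<Rightarrow> int \<times> int \<Rightarrow> bool" where
  "collinear_slopes a b \<longleftrightarrow> (\<exists>x\<in>F. \<exists>y\<in>F. one_bump x \<and> commuting x y \<and> val x = a \<and> val y = b)"

lemma slope_plane_F: "slope_plane F rmul val collinear_slopes"
proof
  show "val ` F = UNIV" by (rule val_surj)
  show "definable_via F rmul val (\<lambda>e. e 0 = e 1)" unfolding definable_via_id_iff[of _ _ val] by (rule definable_via_val_eq)
  show "definable_via F rmul val (\<lambda>e. e 2 = e 0 + e 1)" unfolding definable_via_id_iff[of _ _ val]
  proof (rule G.definable_via_cong)
    show "definable_via F rmul (\<lambda>x. x) (\<lambda>e. \<exists>w\<in>F. rmul (e 0) (e 1) = w \<and> val (e 2) = val w)"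
      by (intro group_rules definable_via_val_eq)
    fix e :: "nat \<Rightarrow> real \<Rightarrow> real" assume "range e \<subseteq> F"
    then have "e 0 \<in> F" "e 1 \<in> F" by auto
    then show "(\<exists>w\<in>F. rmul (e 0) (e 1) = w \<and> val (e 2) = val w) \<longleftrightarrow> val (e 2) = val (e 0) + val (e 1)"
      using rmul_closed val_rmul by auto
  qed
  have quad_val: "quad (val x)" if "x \<in> F" "one_bump x" for x
    using fixfree_val_sign[OF that(1) one_bump_imp_fixfree[OF that]] by (simp add: quad_def)
  have quad_ex: "\<exists>x\<in>F. one_bump x \<and> val x = a" if "quad a" for a
    using that fixfree_exists[of "fst a" "snd a"] unfolding quad_def by (metis prod.collapse)
  show "definable_via F rmul val (\<lambda>e. quad (e 0))" unfolding definable_via_id_iff[of _ _ val]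
  proof (rule G.definable_via_cong)
    show "definable_via F rmul (\<lambda>x. x) (\<lambda>e. \<exists>x\<in>F. one_bump x \<and> val x = val (e 0))"
      by (intro group_rules definable_via_one_bump definable_via_val_eq)
  qed (use quad_val quad_ex in metis)
  show "definable_via F rmul val (\<lambda>e. collinear_slopes (e 0) (e 1))" unfolding definable_via_id_iff[of _ _ val] collinear_slopes_def
    by (intro group_rules definable_via_one_bump definable_via_commuting definable_via_val_eq)
  show "quad a \<and> fst a * snd b = snd a * fst b" if "collinear_slopes a b" for a b
  proof -
    obtain x y where xy: "x \<in> F" "y \<in> F" "one_bump x" "commuting x y" "val x = a" "val y = b"
      using \<open>collinear_slopes a b\<close> by (auto simp: collinear_slopes_def)
    have comm: "x (y u) = y (x u)" for u using xy(4) by (simp add: commuting_iff)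
    have "fst b * snd a = fst a * snd b"
      using commute_collinear[OF xy(1,2) comm F_0[OF xy(1)] F_r[OF xy(1)] F_0[OF xy(2)] F_r[OF xy(2)] r_pos
        one_bump_imp_fixfree[OF xy(1,3)] val_slopes(1)[OF xy(1)] val_slopes(1)[OF xy(2)]
        val_slopes(2)[OF xy(1)] val_slopes(2)[OF xy(2)]] xy(5,6) by simp
    then show ?thesis using quad_val[OF xy(1,3)] xy(5) by (simp add: mult.commute)
  qed
  show "collinear_slopes a (n * fst a, n * snd a)" if "quad a" for a n
  proof -
    obtain x where x: "x \<in> F" "one_bump x" "val x = a" using quad_ex[OF \<open>quad a\<close>] by blast
    have "commuting x (int_pow x n)" using int_pow_commute[OF x(1), of x] by (simp add: commuting_iff)
    then show ?thesis unfolding collinear_slopes_def using x int_pow_in_F[OF x(1), of n] val_int_pow[OF x(1), of n] by blast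
  qed
qed

lemma F_interprets_arith: "interprets_arith F rmul"
  using slope_plane.interprets_arith[OF slope_plane_F] .

end

theorem theoremB:
  fixes r :: real and \<Lambda> A :: "real set"
  assumes r_pos: "r > 0"
    and Lam_pos: "\<Lambda> \<subseteq> {l. l > 0}"
    and Lam_one: "1 \<in> \<Lambda>"
    and Lam_mult: "\<forall>a\<in>\<Lambda>. \<forall>b\<in>\<Lambda>. a * b \<in> \<Lambda>"
    and Lam_inv: "\<forall>a\<in>\<Lambda>. inverse a \<in> \<Lambda>"
    and Lam_nontriv: "\<Lambda> \<noteq> {1}"
    and A_zero: "0 \<in> A"
    and A_add: "\<forall>a\<in>A. \<forall>b\<in>A. a + b \<in> A"
    and A_uminus: "\<forall>a\<in>A. - a \<in> A"
    and r_in_A: "r \<in> A"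
    and A_Lam: "\<forall>l\<in>\<Lambda>. \<forall>a\<in>A. l * a \<in> A"
    and Lam_cyclic: "\<exists>g. \<Lambda> = range (\<lambda>k::int. g powi k)"
  shows "interprets_arith (Fgrp r \<Lambda> A) rmul"
proof -
  obtain g where g: "\<Lambda> = range (\<lambda>k::int. g powi k)" using Lam_cyclic by blast
  then have "g powi 1 \<in> \<Lambda>" by blast
  then have "g > 0" using Lam_pos by auto
  have "g \<noteq> 1" using Lam_nontriv g by auto
  \<comment> \<open>The generator may be below 1; its inverse generates the same group and satisfies
    \<open>p > 1\<close>.\<close>
  define p where "p = (if g > 1 then g else inverse g)"
  have p: "p > 1" using \<open>g > 0\<close> \<open>g \<noteq> 1\<close> by (auto simp: p_def one_less_inverse_iff)
  have "range (\<lambda>k::int. inverse g powi k) = range (\<lambda>k::int. g powi k)"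
  proof -
    have "inverse g powi k = g powi (- k)" "g powi k = inverse g powi (- k)" for k :: int
      by (simp_all add: power_int_minus power_int_inverse)
    then show ?thesis by (metis (no_types, lifting) image_subset_iff rangeI subset_antisym)
  qed
  then have \<Lambda>: "\<Lambda> = range (\<lambda>k::int. p powi k)" using g by (simp add: p_def)
  interpret pl_group r p A
    by unfold_locales (use r_pos p A_zero A_add A_uminus r_in_A A_Lam \<Lambda> in auto)
  show ?thesis using F_interprets_arith by (simp add: \<Lambda> Fgrp_eq_F)
qed

end
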